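(* Consider the procurement setting below with a monotone subadditive valuation $v$. Let $\tilde v(S)$ be the optimal value of the linear program $\min\sum_{j}\alpha_j v(S_j)$ subject to $\alpha_j\ge0$ and $\sum_{j:\, i\in S_j}\alpha_j\ge 1$ for all $i\in S$ (where $S_1,\dots,S_N$ enumerate all subsets of $A$), and let $\mathcal{I}=\max_{S\subseteq A}\mathcal{I}(S)$, where $\mathcal{I}(S)=v(S)/\tilde v(S)$ (with $\mathcal{I}(S)=1$ if $v(S)=0$). The mechanism SA-Mechanism, which computes $\tilde v(S)$ for every $S\subseteq A$ and then runs XOS-Main (described below) with respect to the XOS valuation $\tilde v$ and outputs its result, is budget feasible and (universally) truthful, and has approximation ratio $O(\mathcal{I})$: there is an absolute constant $C$ such that for every cost vector $c$, $v(\mathrm{OPT}(c))\le C\,\mathcal{I}\cdot\mathbb{E}[v(\text{winning set})]$ under truthful bidding. XOS-Main for an XOS valuation $w$: with probability $\frac12$ run XOS-Random-Sample; with probability $\frac12$ pick an item $i\in\arg\max_i w(\{i\})$ as the only winner and pay it $B$. XOS-Random-Sample (on bids $b$): put each item independently with probability $\frac12$ into $T$; compute a set $\mathrm{OPT}(T)$ maximizing $w(S)$ over $S\subseteq T$ with $b(S)\le B$; set $t=w(\mathrm{OPT}(T))/(8B)$; find $S^*\in\arg\max_{S\subseteq A\setminus T}\{w(S)-t\, b(S)\}$ (fixed tie-breaking); find an additive function $f$ in the XOS representation of $w$ with $f(S^* )=w(S^* )$; run AddM for $f$ on $S^*$ with budget $B$ and output its result. Winners are paid threshold payments.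
   Context: Setting: a buyer with budget $B>0$ and a set $A$ of $n$ agents; agent $i$ has a private cost $c(i)\ge0$ (assumed $\le B$). The valuation $v:2^A\to\mathbb{R}_{\ge0}$ is public, monotone, $v(\emptyset)=0$, and subadditive ($v(S)+v(T)\ge v(S\cup T)$). $\mathrm{OPT}(c)$ maximizes $v(S)$ subject to $c(S)\le B$. A mechanism takes bids $b(i)$, chooses winners and payments $p(i)$ with $p(i)=0$ for losers and $p(i)\ge b(i)$ for winners; utility is $p(i)-c(i)$ for winners, $0$ otherwise. Universally truthful: a distribution over deterministic mechanisms in each of which truthful bidding is a dominant strategy. Budget feasible: $\sum_i p(i)\le B$. A function is XOS if it is a maximum of nonnegative additive functions. AddM is a fixed universally truthful, budget feasible mechanism for additive valuations (from prior work) with approximation ratio at most $3$. Threshold payment: the supremum bid with which the agent still wins under the monotone allocation rule. *)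

theory Defs
  imports "HOL-Probability.Probability"
begin

text \<open>Agents are natural numbers; the agent set A is a finite set of naturals.
  A bid/cost vector is a function nat to real; only its values on A matter.
  A deterministic mechanism maps a bid vector to (winning set, payments).\<close>

type_synonym bids = "nat \<Rightarrow> real"
type_synonym mech = "bids \<Rightarrow> nat set \<times> (nat \<Rightarrow> real)"

definition valid_bids :: "nat set \<Rightarrow> real \<Rightarrow> bids \<Rightarrow> bool" where
  "valid_bids A B b \<longleftrightarrow> (\<forall>i\<in>A. 0 \<le> b i \<and> b i \<le> B)"

definition is_mech :: "nat set \<Rightarrow> real \<Rightarrow> mech \<Rightarrow> bool" where
  "is_mech A B m \<longleftrightarrow> (\<forall>b. valid_bids A B b \<longrightarrow>
      fst (m b) \<subseteq> A \<and>
      (\<forall>i\<in>A. (i \<notin> fst (m b) \<longrightarrow> snd (m b) i = 0) \<and>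
              (i \<in> fst (m b) \<longrightarrow> b i \<le> snd (m b) i)))"

definition utility :: "nat \<Rightarrow> real \<Rightarrow> nat set \<times> (nat \<Rightarrow> real) \<Rightarrow> real" where
  "utility i c out = (if i \<in> fst out then snd out i - c else 0)"

definition truthful :: "nat set \<Rightarrow> real \<Rightarrow> mech \<Rightarrow> bool" where
  "truthful A B m \<longleftrightarrow> (\<forall>b i x. valid_bids A B b \<longrightarrow> i \<in> A \<longrightarrow> 0 \<le> x \<longrightarrow> x \<le> B \<longrightarrow>
      utility i (b i) (m (b(i := x))) \<le> utility i (b i) (m b))"

definition budget_feasible :: "nat set \<Rightarrow> real \<Rightarrow> mech \<Rightarrow> bool" where
  "budget_feasible A B m \<longleftrightarrow> (\<forall>b. valid_bids A B b \<longrightarrow> (\<Sum>i\<in>A. snd (m b) i) \<le> B)"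

definition universally_truthful :: "nat set \<Rightarrow> real \<Rightarrow> mech pmf \<Rightarrow> bool" where
  "universally_truthful A B M \<longleftrightarrow> (\<forall>m\<in>set_pmf M. is_mech A B m \<and> truthful A B m)"

definition universally_budget_feasible :: "nat set \<Rightarrow> real \<Rightarrow> mech pmf \<Rightarrow> bool" where
  "universally_budget_feasible A B M \<longleftrightarrow> (\<forall>m\<in>set_pmf M. budget_feasible A B m)"

definition opt_val :: "nat set \<Rightarrow> real \<Rightarrow> (nat set \<Rightarrow> real) \<Rightarrow> bids \<Rightarrow> real" where
  "opt_val A B v c = Max (v ` {S. S \<subseteq> A \<and> sum c S \<le> B})"

definition frac_cover :: "nat set \<Rightarrow> (nat set \<Rightarrow> real) \<Rightarrow> nat set \<Rightarrow> real" where
  "frac_cover A v S = Inf {\<Sum>T\<in>Pow A. \<alpha> T * v T | \<alpha>.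
      (\<forall>T. 0 \<le> \<alpha> T) \<and> (\<forall>i\<in>S. 1 \<le> (\<Sum>T\<in>{T\<in>Pow A. i \<in> T}. \<alpha> T))}"

definition gap_ratio :: "nat set \<Rightarrow> (nat set \<Rightarrow> real) \<Rightarrow> nat set \<Rightarrow> real" where
  "gap_ratio A v S = (if v S = 0 then 1 else v S / frac_cover A v S)"

definition gapI :: "nat set \<Rightarrow> (nat set \<Rightarrow> real) \<Rightarrow> real" where
  "gapI A v = Max (gap_ratio A v ` Pow A)"

definition xos_topt :: "real \<Rightarrow> (nat set \<Rightarrow> real) \<Rightarrow> nat set \<Rightarrow> bids \<Rightarrow> real" where
  "xos_topt B w T b = Max (w ` {S. S \<subseteq> T \<and> sum b S \<le> B})"

definition sstar :: "nat set \<Rightarrow> real \<Rightarrow> (nat set \<Rightarrow> real) \<Rightarrow> (nat set \<Rightarrow> nat) \<Rightarrow> nat set \<Rightarrow> bids \<Rightarrow> nat set" where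
  "sstar A B w prio T b =
     (let t = xos_topt B w T b / (8 * B);
          F = Pow (A - T);
          M = {S\<in>F. \<forall>S'\<in>F. w S' - t * sum b S' \<le> w S - t * sum b S}
      in (SOME S. S \<in> M \<and> (\<forall>S'\<in>M. prio S \<le> prio S')))"

definition xos_supp :: "nat set \<Rightarrow> (nat set \<Rightarrow> real) \<Rightarrow> nat set \<Rightarrow> (nat \<Rightarrow> real)" where
  "xos_supp A w S = (SOME f. (\<forall>i. 0 \<le> f i) \<and> (\<forall>T\<subseteq>A. sum f T \<le> w T) \<and> sum f S = w S)"

definition thr_mech :: "real \<Rightarrow> (bids \<Rightarrow> nat set) \<Rightarrow> mech" where
  "thr_mech B alloc = (\<lambda>b. (alloc b, \<lambda>i. if i \<in> alloc b
       then Sup {x. 0 \<le> x \<and> x \<le> B \<and> i \<in> alloc (b(i := x))} else 0))"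

definition null_mech :: mech where
  "null_mech = (\<lambda>b. ({}, \<lambda>i. 0))"

text \<open>addm f S: the (universally truthful) AddM for additive valuation with weights f,
  run on agent set S with budget B, as a distribution over deterministic mechanisms.
  For a fixed sample T, independent AddM realisations are drawn for every candidate S*.\<close>
definition xos_random_sample ::
  "nat set \<Rightarrow> real \<Rightarrow> (nat set \<Rightarrow> real) \<Rightarrow> (nat set \<Rightarrow> nat) \<Rightarrow>
   ((nat \<Rightarrow> real) \<Rightarrow> nat set \<Rightarrow> mech pmf) \<Rightarrow> mech pmf" where
  "xos_random_sample A B w prio addm =
     bind_pmf (Pi_pmf A False (\<lambda>_. bernoulli_pmf (1/2))) (\<lambda>g.
       let T = {i\<in>A. g i} in
       bind_pmf (Pi_pmf (Pow (A - T)) null_mech (\<lambda>S. addm (xos_supp A w S) S)) (\<lambda>mf.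
         return_pmf (thr_mech B (\<lambda>b. fst (mf (sstar A B w prio T b) b)))))"

definition max_item_mech :: "nat set \<Rightarrow> real \<Rightarrow> (nat set \<Rightarrow> real) \<Rightarrow> mech" where
  "max_item_mech A B w =
     (let i = (SOME i. i \<in> A \<and> (\<forall>j\<in>A. w {j} \<le> w {i})) in
      (\<lambda>b. ({i}, \<lambda>j. if j = i then B else 0)))"

definition xos_main ::
  "nat set \<Rightarrow> real \<Rightarrow> (nat set \<Rightarrow> real) \<Rightarrow> (nat set \<Rightarrow> nat) \<Rightarrow>
   ((nat \<Rightarrow> real) \<Rightarrow> nat set \<Rightarrow> mech pmf) \<Rightarrow> mech pmf" where
  "xos_main A B w prio addm =
     bind_pmf (bernoulli_pmf (1/2)) (\<lambda>coin.
       if coin then xos_random_sample A B w prio addm else return_pmf (max_item_mech A B w))"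

definition sa_mech ::
  "nat set \<Rightarrow> real \<Rightarrow> (nat set \<Rightarrow> real) \<Rightarrow> (nat set \<Rightarrow> nat) \<Rightarrow>
   ((nat \<Rightarrow> real) \<Rightarrow> nat set \<Rightarrow> mech pmf) \<Rightarrow> mech pmf" where
  "sa_mech A B v prio addm = xos_main A B (frac_cover A v) prio addm"

definition addm_ok :: "nat set \<Rightarrow> real \<Rightarrow> ((nat \<Rightarrow> real) \<Rightarrow> nat set \<Rightarrow> mech pmf) \<Rightarrow> bool" where
  "addm_ok A B addm \<longleftrightarrow> (\<forall>f S. (\<forall>i. 0 \<le> f i) \<longrightarrow> S \<subseteq> A \<longrightarrow>
      (\<forall>m\<in>set_pmf (addm f S). is_mech A B m \<and> truthful A B m \<and> budget_feasible A B m \<and>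
          (\<forall>b. valid_bids A B b \<longrightarrow> fst (m b) \<subseteq> S)) \<and>
      (\<forall>c. valid_bids A B c \<longrightarrow>
          Max (sum f ` {S'. S' \<subseteq> S \<and> sum c S' \<le> B})
            \<le> 3 * measure_pmf.expectation (addm f S) (\<lambda>m. sum f (fst (m c)))))"

end

theory Submission
  imports Defs
begin

text \<open>
  The fractional cover value \<open>w\<close> of \<open>v\<close> is XOS by linear programming duality, which is
  obtained here as a finite-dimensional Hahn--Banach argument for the sublinear functional mapping a
  demand vector to the least cost of covering it. Since \<open>w \<le> v \<le> gapI \<cdot> w\<close>, it suffices to treat
  \<open>w\<close> and lose only a constant factor.

  If a winner lowers its bid, the demanded set \<open>S\<^sup>*\<close> stays the same, so the composed allocation
  inherits monotonicity from AddM, and its threshold payments are at most the payments of AddM on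
  \<open>S\<^sup>*\<close>.

  For the approximation, let \<open>f\<close> be an additive function supporting an optimal set \<open>O\<close> of value \<open>F\<close>,
  and let \<open>X = f(O \<inter> T)\<close> and \<open>Y = f(O - T)\<close>. Either \<open>S\<^sup>*\<close> is affordable and worth \<open>Y - F / 8\<close>,
  or it has an affordable subset of cost at least \<open>B / 2\<close>, which is worth \<open>X / 16\<close> because every
  subset of \<open>S\<^sup>*\<close> is worth at least \<open>t\<close> times its cost. In both cases the value is bounded below by a
  multiple of \<open>X Y / F - 7 F / 64\<close>, and the expectation of \<open>X Y\<close> is a quarter of
  \<open>F\<^sup>2 - (\<Sum>i\<in>O. f(i)\<^sup>2)\<close>; the loss is compensated by the most valuable single item.
\<close>

section \<open>Fractional covers are XOS\<close>

definition sublinear :: "(('a \<Rightarrow> real) \<Rightarrow> real) \<Rightarrow> bool" where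
  "sublinear p \<longleftrightarrow> (\<forall>x y. p (\<lambda>i. x i + y i) \<le> p x + p y) \<and>
     (\<forall>a x. 0 < a \<longrightarrow> p (\<lambda>i. a * x i) \<le> a * p x) \<and> p (\<lambda>i. 0) = 0"

lemma sublinear_add: "sublinear p \<Longrightarrow> p (\<lambda>i. x i + y i) \<le> p x + p y"
  by (simp add: sublinear_def)

lemma sublinear_scale_le: "sublinear p \<Longrightarrow> 0 < a \<Longrightarrow> p (\<lambda>i. a * x i) \<le> a * p x"
  by (simp add: sublinear_def)

lemma sublinear_zero: "sublinear p \<Longrightarrow> p (\<lambda>i. 0) = 0"
  by (simp add: sublinear_def)

text \<open>The reverse inequality follows by scaling back with \<open>inverse a\<close>. The
  definition therefore asks for one inequality only, the one that is easy to check for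
  infima.\<close>

lemma sublinear_scale:
  assumes p: "sublinear p" and a: "0 \<le> a"
  shows "p (\<lambda>i. a * x i) = a * p x"
proof (cases "a = 0")
  case True
  then show ?thesis using sublinear_zero[OF p] by simp
next
  case False
  with a have a: "0 < a" by simp
  have "p (\<lambda>i. inverse a * (a * x i)) \<le> inverse a * p (\<lambda>i. a * x i)"
    using sublinear_scale_le[OF p, of "inverse a" "\<lambda>i. a * x i"] a by simp
  moreover have "(\<lambda>i. inverse a * (a * x i)) = x" using a by (auto simp: field_simps)
  ultimately have "a * p x \<le> p (\<lambda>i. a * x i)" using a by (simp add: field_simps)
  then show ?thesis using sublinear_scale_le[OF p a, of x] by simp
qed

lemma sublinear_neg:
  assumes "sublinear p" shows "- p (\<lambda>i. - x i) \<le> p x"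
  using sublinear_add[OF assms, of x "\<lambda>i. - x i"] sublinear_zero[OF assms] by simp

lemma sublinear_sum_le:
  assumes "sublinear p" "finite I"
  shows "p (\<lambda>i. \<Sum>j\<in>I. x j i) \<le> (\<Sum>j\<in>I. p (x j))"
  using assms(2)
proof (induction I)
  case empty
  then show ?case using sublinear_zero[OF assms(1)] by simp
next
  case (insert j I)
  have "p (\<lambda>i. \<Sum>j\<in>insert j I. x j i) = p (\<lambda>i. x j i + (\<Sum>j\<in>I. x j i))"
    using insert by simp
  also have "\<dots> \<le> p (x j) + p (\<lambda>i. \<Sum>j\<in>I. x j i)" by (rule sublinear_add[OF assms(1)])
  finally show ?case using insert by simp
qed

text \<open>The infimum of \<open>p (x + s u) - s p u\<close> over \<open>s \<ge> 0\<close> is again sublinear, lies below \<open>p\<close>,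
  and is linear along \<open>u\<close>; this replaces the one-step extension in the Hahn--Banach theorem.\<close>

lemma sublinear_linearize:
  assumes p: "sublinear p"
  obtains q where "sublinear q" "\<And>x. q x \<le> p x" "q (\<lambda>i. - u i) = - p u"
proof -
  define V where "V x = {p (\<lambda>i. x i + s * u i) - s * p u | s. 0 \<le> s}" for x
  define q where "q x = Inf (V x)" for x
  have ne: "V x \<noteq> {}" for x unfolding V_def by auto
  have lb: "- p (\<lambda>i. - x i) \<le> y" if "y \<in> V x" for x y
  proof -
    from that obtain s where s: "0 \<le> s" "y = p (\<lambda>i. x i + s * u i) - s * p u"
      by (auto simp: V_def)
    have "p (\<lambda>i. s * u i) \<le> p (\<lambda>i. x i + s * u i) + p (\<lambda>i. - x i)"
      using sublinear_add[OF p, of "\<lambda>i. x i + s * u i" "\<lambda>i. - x i"] by simp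
    then show ?thesis using s sublinear_scale[OF p s(1), of u] by simp
  qed
  have bdd: "bdd_below (V x)" for x using lb by (meson bdd_belowI)
  have le: "q x \<le> p (\<lambda>i. x i + s * u i) - s * p u" if "0 \<le> s" for x s
    unfolding q_def using that by (intro cInf_lower bdd) (auto simp: V_def)
  have ge: "z \<le> q x" if "\<And>s. 0 \<le> s \<Longrightarrow> z \<le> p (\<lambda>i. x i + s * u i) - s * p u" for z x
    unfolding q_def using that by (intro cInf_greatest ne) (auto simp: V_def)
  have qp: "q x \<le> p x" for x using le[of 0 x] by simp
  have qlb: "- p (\<lambda>i. - x i) \<le> q x" for x
    unfolding q_def by (intro cInf_greatest ne lb)
  have q0: "q (\<lambda>i. 0) = 0"
    using qp[of "\<lambda>i. 0"] qlb[of "\<lambda>i. 0"] sublinear_zero[OF p] by simp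
  have qadd: "q (\<lambda>i. x i + y i) \<le> q x + q y" for x y
  proof -
    \<comment> \<open>Representatives at \<open>s\<close> and \<open>t\<close> combine to one at
      \<open>s + t\<close>. The infima over \<open>t\<close> and then over \<open>s\<close> are
      taken one at a time afterwards.\<close>
    have 1: "q (\<lambda>i. x i + y i) \<le> (p (\<lambda>i. x i + s * u i) - s * p u) + (p (\<lambda>i. y i + t * u i) - t * p u)"
      if "0 \<le> s" "0 \<le> t" for s t
    proof -
      have "q (\<lambda>i. x i + y i) \<le> p (\<lambda>i. x i + y i + (s + t) * u i) - (s + t) * p u"
        using le[of "s + t" "\<lambda>i. x i + y i"] that by simp
      also have "(\<lambda>i. x i + y i + (s + t) * u i) = (\<lambda>i. (x i + s * u i) + (y i + t * u i))"
        by (auto simp: algebra_simps)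
      finally show ?thesis
        using sublinear_add[OF p, of "\<lambda>i. x i + s * u i" "\<lambda>i. y i + t * u i"]
        by (simp add: algebra_simps)
    qed
    have 2: "q (\<lambda>i. x i + y i) - (p (\<lambda>i. x i + s * u i) - s * p u) \<le> q y" if "0 \<le> s" for s
    proof (rule ge)
      fix t :: real assume "0 \<le> t"
      from 1[OF that this] show "q (\<lambda>i. x i + y i) - (p (\<lambda>i. x i + s * u i) - s * p u)
         \<le> p (\<lambda>i. y i + t * u i) - t * p u" by simp
    qed
    have "q (\<lambda>i. x i + y i) - q y \<le> q x"
    proof (rule ge)
      fix s :: real assume "0 \<le> s"
      from 2[OF this] show "q (\<lambda>i. x i + y i) - q y \<le> p (\<lambda>i. x i + s * u i) - s * p u" by simp
    qed
    then show ?thesis by simp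
  qed
  have qscale: "q (\<lambda>i. a * x i) \<le> a * q x" if a: "0 < a" for a x
  proof -
    have "q (\<lambda>i. a * x i) / a \<le> q x"
    proof (rule ge)
      fix s :: real assume s: "0 \<le> s"
      have "q (\<lambda>i. a * x i) \<le> p (\<lambda>i. a * x i + (a * s) * u i) - (a * s) * p u"
        using le[of "a * s" "\<lambda>i. a * x i"] a s by simp
      also have "(\<lambda>i. a * x i + (a * s) * u i) = (\<lambda>i. a * (x i + s * u i))"
        by (auto simp: algebra_simps)
      also have "p \<dots> = a * p (\<lambda>i. x i + s * u i)" using a by (intro sublinear_scale[OF p]) simp
      finally show "q (\<lambda>i. a * x i) / a \<le> p (\<lambda>i. x i + s * u i) - s * p u"
        using a by (simp add: field_simps)
    qed
    then show ?thesis using a by (simp add: field_simps)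
  qed
  \<comment> \<open>At \<open>s = 1\<close> the shift cancels \<open>- u\<close>, leaving
    \<open>p 0 - p u\<close>.\<close>
  have "q (\<lambda>i. - u i) \<le> - p u"
    using le[of 1 "\<lambda>i. - u i"] sublinear_zero[OF p] by simp
  moreover have "- p u \<le> q (\<lambda>i. - u i)" using qlb[of "\<lambda>i. - u i"] by simp
  ultimately have "q (\<lambda>i. - u i) = - p u" by simp
  moreover have "sublinear q" unfolding sublinear_def using q0 qadd qscale by blast
  ultimately show ?thesis using qp that by blast
qed

text \<open>Linearity along \<open>u\<close> survives further shrinking: if
  \<open>q \<le> r \<le> p\<close> and \<open>r (- u) = - p u\<close>, then
  \<open>p u \<le> - q (- u) \<le> q u \<le> p u\<close>, so equality holds throughout. Only the
  head is sure to keep its value under the original \<open>p\<close>; later vectors are linearized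
  for a smaller functional.\<close>

lemma sublinear_linearize_list:
  assumes "sublinear p"
  shows "\<exists>q. sublinear q \<and> (\<forall>x. q x \<le> p x) \<and> (\<forall>u\<in>set us. q (\<lambda>i. - u i) = - q u) \<and>
    (us \<noteq> [] \<longrightarrow> q (hd us) = p (hd us))"
  using assms
proof (induction us arbitrary: p)
  case Nil
  then show ?case by auto
next
  case (Cons u us)
  obtain r where r: "sublinear r" "\<And>x. r x \<le> p x" "r (\<lambda>i. - u i) = - p u"
    using sublinear_linearize[OF Cons.prems] by blast
  obtain q where q: "sublinear q" "\<And>x. q x \<le> r x" "\<forall>u\<in>set us. q (\<lambda>i. - u i) = - q u"
    using Cons.IH[OF r(1)] by blast
  have "q (\<lambda>i. - u i) \<le> - p u" using q(2)[of "\<lambda>i. - u i"] r(3) by simp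
  moreover have "- q (\<lambda>i. - u i) \<le> q u" by (rule sublinear_neg[OF q(1)])
  moreover have "q u \<le> p u" using q(2) r(2) order_trans by blast
  ultimately have "q u = p u" "q (\<lambda>i. - u i) = - q u" by simp_all
  then show ?case using q r(2) by (intro exI[of _ q]) (auto intro: order_trans)
qed

section \<open>The covering program and its duality\<close>

definition xos_on :: "nat set \<Rightarrow> (nat set \<Rightarrow> real) \<Rightarrow> bool" where
  "xos_on A w \<longleftrightarrow> (\<forall>S\<subseteq>A. \<exists>f. (\<forall>i. 0 \<le> f i) \<and> (\<forall>T\<subseteq>A. sum f T \<le> w T) \<and> sum f S = w S)"

text \<open>The program of \<open>frac_cover\<close> with an arbitrary real demand vector in place
  of the indicator of a set. This gives a functional on a vector space, to which the Hahn--Banach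
  argument applies.\<close>

definition cover_cost :: "nat set \<Rightarrow> (nat set \<Rightarrow> real) \<Rightarrow> (nat \<Rightarrow> real) \<Rightarrow> real" where
  "cover_cost A v x = Inf {\<Sum>T\<in>Pow A. \<alpha> T * v T | \<alpha>.
      (\<forall>T. 0 \<le> \<alpha> T) \<and> (\<forall>i\<in>A. x i \<le> (\<Sum>T\<in>{T\<in>Pow A. i \<in> T}. \<alpha> T))}"

context
  fixes A :: "nat set" and v :: "nat set \<Rightarrow> real"
  assumes fin: "finite A" and nonneg: "\<And>S. S \<subseteq> A \<Longrightarrow> 0 \<le> v S"
begin

lemma cover_cost_le:
  assumes "\<And>T. 0 \<le> \<alpha> T" "\<And>i. i \<in> A \<Longrightarrow> x i \<le> (\<Sum>T\<in>{T\<in>Pow A. i \<in> T}. \<alpha> T)"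
  shows "cover_cost A v x \<le> (\<Sum>T\<in>Pow A. \<alpha> T * v T)"
  unfolding cover_cost_def
proof (rule cInf_lower)
  show "bdd_below {\<Sum>T\<in>Pow A. \<alpha> T * v T | \<alpha>.
      (\<forall>T. 0 \<le> \<alpha> T) \<and> (\<forall>i\<in>A. x i \<le> (\<Sum>T\<in>{T\<in>Pow A. i \<in> T}. \<alpha> T))}"
    by (rule bdd_belowI[where m = 0]) (auto intro!: sum_nonneg mult_nonneg_nonneg nonneg)
qed (use assms in auto)

lemma cover_cost_ge:
  assumes "\<And>\<alpha>. (\<And>T. 0 \<le> \<alpha> T) \<Longrightarrow> (\<And>i. i \<in> A \<Longrightarrow> x i \<le> (\<Sum>T\<in>{T\<in>Pow A. i \<in> T}. \<alpha> T)) \<Longrightarrow>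
    z \<le> (\<Sum>T\<in>Pow A. \<alpha> T * v T)"
  shows "z \<le> cover_cost A v x"
  unfolding cover_cost_def
proof (rule cInf_greatest)
  \<comment> \<open>The infimum ranges over a nonempty set: enough weight on the whole of
    \<open>A\<close> meets every demand at once.\<close>
  define a where "a T = (if T = A then (\<Sum>i\<in>A. \<bar>x i\<bar>) else 0)" for T
  have "x i \<le> (\<Sum>T\<in>{T\<in>Pow A. i \<in> T}. a T)" if "i \<in> A" for i
  proof -
    have "x i \<le> \<bar>x i\<bar>" by simp
    also have "\<dots> \<le> (\<Sum>i\<in>A. \<bar>x i\<bar>)" using fin that by (intro member_le_sum) auto
    also have "\<dots> = (\<Sum>T\<in>{T\<in>Pow A. i \<in> T}. a T)"
      using fin that by (simp add: a_def sum.delta)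
    finally show ?thesis .
  qed
  moreover have "0 \<le> a T" for T by (auto simp: a_def intro: sum_nonneg)
  ultimately show "{\<Sum>T\<in>Pow A. \<alpha> T * v T | \<alpha>.
      (\<forall>T. 0 \<le> \<alpha> T) \<and> (\<forall>i\<in>A. x i \<le> (\<Sum>T\<in>{T\<in>Pow A. i \<in> T}. \<alpha> T))} \<noteq> {}" by blast
qed (use assms in auto)

lemma cover_cost_nonneg: "0 \<le> cover_cost A v x"
  by (rule cover_cost_ge) (auto intro!: sum_nonneg mult_nonneg_nonneg nonneg)

text \<open>The zero cover is feasible. Applied to negated unit vectors, this makes the weights of
  the supporting additive function nonnegative.\<close>

lemma cover_cost_nonpos:
  assumes "\<And>i. i \<in> A \<Longrightarrow> x i \<le> 0" shows "cover_cost A v x = 0"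
proof (rule antisym)
  show "cover_cost A v x \<le> 0" using cover_cost_le[of "\<lambda>_. 0" x] assms by simp
qed (rule cover_cost_nonneg)

text \<open>Covers can be added and scaled, and so can their costs. For subadditivity the two infima
  are again reached one after the other.\<close>

lemma sublinear_cover_cost: "sublinear (cover_cost A v)"
  unfolding sublinear_def
proof (intro conjI allI impI)
  fix x y :: "nat \<Rightarrow> real"
  let ?p = "cover_cost A v"
  have 1: "?p (\<lambda>i. x i + y i) \<le> (\<Sum>T\<in>Pow A. \<alpha> T * v T) + (\<Sum>T\<in>Pow A. \<beta> T * v T)"
    if "\<And>T. 0 \<le> \<alpha> T" "\<And>i. i \<in> A \<Longrightarrow> x i \<le> (\<Sum>T\<in>{T\<in>Pow A. i \<in> T}. \<alpha> T)"
      "\<And>T. 0 \<le> \<beta> T" "\<And>i. i \<in> A \<Longrightarrow> y i \<le> (\<Sum>T\<in>{T\<in>Pow A. i \<in> T}. \<beta> T)" for \<alpha> \<beta>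
    using cover_cost_le[of "\<lambda>T. \<alpha> T + \<beta> T" "\<lambda>i. x i + y i"] that
    by (simp add: sum.distrib algebra_simps add_mono)
  have 2: "?p (\<lambda>i. x i + y i) - (\<Sum>T\<in>Pow A. \<alpha> T * v T) \<le> ?p y"
    if "\<And>T. 0 \<le> \<alpha> T" "\<And>i. i \<in> A \<Longrightarrow> x i \<le> (\<Sum>T\<in>{T\<in>Pow A. i \<in> T}. \<alpha> T)" for \<alpha>
  proof (rule cover_cost_ge)
    fix \<beta> :: "nat set \<Rightarrow> real"
    assume "\<And>T. 0 \<le> \<beta> T" "\<And>i. i \<in> A \<Longrightarrow> y i \<le> (\<Sum>T\<in>{T\<in>Pow A. i \<in> T}. \<beta> T)"
    from 1[OF that this] show "?p (\<lambda>i. x i + y i) - (\<Sum>T\<in>Pow A. \<alpha> T * v T)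
      \<le> (\<Sum>T\<in>Pow A. \<beta> T * v T)" by simp
  qed
  have "?p (\<lambda>i. x i + y i) - ?p y \<le> ?p x"
  proof (rule cover_cost_ge)
    fix \<alpha> :: "nat set \<Rightarrow> real"
    assume "\<And>T. 0 \<le> \<alpha> T" "\<And>i. i \<in> A \<Longrightarrow> x i \<le> (\<Sum>T\<in>{T\<in>Pow A. i \<in> T}. \<alpha> T)"
    from 2[OF this] show "?p (\<lambda>i. x i + y i) - ?p y \<le> (\<Sum>T\<in>Pow A. \<alpha> T * v T)" by simp
  qed
  then show "?p (\<lambda>i. x i + y i) \<le> ?p x + ?p y" by simp
next
  fix a :: real and x :: "nat \<Rightarrow> real"
  assume a: "0 < a"
  let ?p = "cover_cost A v"
  have "?p (\<lambda>i. a * x i) / a \<le> ?p x"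
  proof (rule cover_cost_ge)
    fix \<alpha> :: "nat set \<Rightarrow> real"
    assume "\<And>T. 0 \<le> \<alpha> T" "\<And>i. i \<in> A \<Longrightarrow> x i \<le> (\<Sum>T\<in>{T\<in>Pow A. i \<in> T}. \<alpha> T)"
    then have "?p (\<lambda>i. a * x i) \<le> a * (\<Sum>T\<in>Pow A. \<alpha> T * v T)"
      using cover_cost_le[of "\<lambda>T. a * \<alpha> T" "\<lambda>i. a * x i"] a
      by (simp add: sum_distrib_left[symmetric] mult.assoc)
    then show "?p (\<lambda>i. a * x i) / a \<le> (\<Sum>T\<in>Pow A. \<alpha> T * v T)"
      using a by (simp add: field_simps)
  qed
  then show "?p (\<lambda>i. a * x i) \<le> a * ?p x" using a by (simp add: field_simps)
next
  show "cover_cost A v (\<lambda>i. 0) = 0" by (rule cover_cost_nonpos) simp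
qed

text \<open>Items of \<open>A\<close> outside \<open>S\<close> have demand zero, which nonnegative
  weights always meet.\<close>

lemma frac_cover_eq_cover_cost:
  assumes "S \<subseteq> A" shows "frac_cover A v S = cover_cost A v (indicator S)"
proof -
  have "(\<forall>i\<in>S. 1 \<le> (\<Sum>T\<in>{T\<in>Pow A. i \<in> T}. \<alpha> T)) \<longleftrightarrow>
      (\<forall>i\<in>A. indicator S i \<le> (\<Sum>T\<in>{T\<in>Pow A. i \<in> T}. \<alpha> T))"
    if "\<forall>T. 0 \<le> \<alpha> T" for \<alpha> :: "nat set \<Rightarrow> real"
    using assms that by (auto simp: indicator_def intro!: sum_nonneg)
  then show ?thesis unfolding frac_cover_def cover_cost_def
    by (intro arg_cong[of _ _ Inf] Collect_cong ex_cong1 conj_cong refl) auto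
qed

lemma frac_cover_le: assumes "S \<subseteq> A" shows "frac_cover A v S \<le> v S"
proof -
  define a :: "nat set \<Rightarrow> real" where "a T = (if T = S then 1 else 0)" for T
  have "cover_cost A v (indicator S) \<le> (\<Sum>T\<in>Pow A. a T * v T)"
  proof (rule cover_cost_le)
    show "indicator S i \<le> (\<Sum>T\<in>{T\<in>Pow A. i \<in> T}. a T)" for i
      using fin assms by (auto simp: a_def sum.delta indicator_def)
  qed (simp add: a_def)
  also have "\<dots> = (\<Sum>T\<in>Pow A. if T = S then v T else 0)"
    by (rule sum.cong) (auto simp: a_def)
  also have "\<dots> = v S" using fin assms by (simp add: sum.delta)
  finally show ?thesis using frac_cover_eq_cover_cost[OF assms] by simp
qed

text \<open>Sets containing \<open>j\<close> carry total weight at least one, and each is worth at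
  least \<open>v {j}\<close>. This keeps the denominator of \<open>gap_ratio\<close>
  positive.\<close>

lemma frac_cover_singleton_le:
  assumes "\<And>S T. S \<subseteq> T \<Longrightarrow> T \<subseteq> A \<Longrightarrow> v S \<le> v T" "S \<subseteq> A" "j \<in> S"
  shows "v {j} \<le> frac_cover A v S"
  unfolding frac_cover_eq_cover_cost[OF assms(2)]
proof (rule cover_cost_ge)
  fix \<alpha> :: "nat set \<Rightarrow> real"
  assume a: "\<And>T. 0 \<le> \<alpha> T"
    "\<And>i. i \<in> A \<Longrightarrow> indicator S i \<le> (\<Sum>T\<in>{T\<in>Pow A. i \<in> T}. \<alpha> T)"
  have "1 * v {j} \<le> (\<Sum>T\<in>{T\<in>Pow A. j \<in> T}. \<alpha> T) * v {j}"
    using a(2)[of j] assms nonneg[of "{j}"] by (intro mult_right_mono) auto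
  also have "\<dots> = (\<Sum>T\<in>{T\<in>Pow A. j \<in> T}. \<alpha> T * v {j})" by (rule sum_distrib_right)
  also have "\<dots> \<le> (\<Sum>T\<in>{T\<in>Pow A. j \<in> T}. \<alpha> T * v T)"
    using a(1) assms(1) by (intro sum_mono mult_left_mono) auto
  also have "\<dots> \<le> (\<Sum>T\<in>Pow A. \<alpha> T * v T)"
    using fin a(1) nonneg by (intro sum_mono2) auto
  finally show "v {j} \<le> (\<Sum>T\<in>Pow A. \<alpha> T * v T)" by simp
qed

text \<open>A linear functional below \<open>cover_cost\<close> and tight at the indicator of
  \<open>S\<close> is a dual optimum; its values on unit vectors are the supporting additive
  function.\<close>

lemma xos_on_frac_cover: "xos_on A (frac_cover A v)"
  unfolding xos_on_def
proof (intro allI impI)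
  fix S assume S: "S \<subseteq> A"
  obtain as where as: "set as = A" using finite_list[OF fin] by blast
  \<comment> \<open>The indicator of \<open>S\<close> comes first so that its value is kept; the
    unit vectors follow so that \<open>q\<close> becomes linear along each coordinate.\<close>
  define us :: "(nat \<Rightarrow> real) list" where "us = indicator S # map (\<lambda>i. indicator {i}) as"
  obtain q where q: "sublinear q" "\<And>x. q x \<le> cover_cost A v x"
      "\<forall>u\<in>set us. q (\<lambda>i. - u i) = - q u" "q (hd us) = cover_cost A v (hd us)"
    using sublinear_linearize_list[OF sublinear_cover_cost, of us] by (auto simp: us_def)
  define f where "f i = (if i \<in> A then q (indicator {i}) else 0)" for i
  have neg: "q (\<lambda>k. - indicator {i} k) = - q (indicator {i})" if "i \<in> A" for i
    using q(3) that as by (auto simp: us_def)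
  \<comment> \<open>A negated unit vector costs nothing to cover, so
    \<open>- f i \<le> 0\<close>.\<close>
  have f0: "0 \<le> f i" for i
    using q(2)[of "\<lambda>k. - indicator {i} k"] cover_cost_nonpos[of "\<lambda>k. - indicator {i} k"] neg[of i]
    by (auto simp: f_def)
  \<comment> \<open>Subadditivity over the unit vectors and over their negatives gives
    \<open>q 1_T \<le> sum f T \<le> - q (- 1_T) \<le> q 1_T\<close>, where \<open>1_T\<close> is
    the indicator of \<open>T\<close>.\<close>
  have fsum: "sum f T = q (indicator T)" if T: "T \<subseteq> A" for T
  proof -
    have finT: "finite T" using T fin finite_subset by blast
    have ind: "(\<lambda>k. \<Sum>i\<in>T. indicator {i} k) = (indicator T :: nat \<Rightarrow> real)"
      using finT by (auto simp: indicator_def of_bool_def sum.delta fun_eq_iff)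
    have ind': "(\<lambda>k. \<Sum>i\<in>T. - indicator {i} k) = (\<lambda>k. - indicator T k :: real)"
      using ind by (simp add: sum_negf fun_eq_iff)
    have eq: "sum f T = (\<Sum>i\<in>T. q (indicator {i}))"
      using T by (intro sum.cong) (auto simp: f_def)
    have "q (indicator T) \<le> sum f T"
      using sublinear_sum_le[OF q(1) finT, of "\<lambda>i. indicator {i}"] ind eq by simp
    moreover have "q (\<lambda>k. - indicator T k) \<le> (\<Sum>i\<in>T. q (\<lambda>k. - indicator {i} k))"
      using sublinear_sum_le[OF q(1) finT, of "\<lambda>i k. - indicator {i} k"] ind' by simp
    moreover have "(\<Sum>i\<in>T. q (\<lambda>k. - indicator {i} k)) = - sum f T"
      unfolding eq using T neg by (subst sum_negf[symmetric], intro sum.cong) auto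
    ultimately show ?thesis using sublinear_neg[OF q(1), of "indicator T"] by simp
  qed
  have "sum f T \<le> frac_cover A v T" if "T \<subseteq> A" for T
    using fsum[OF that] q(2) frac_cover_eq_cover_cost[OF that] by simp
  moreover have "sum f S = frac_cover A v S"
    using fsum[OF S] q(4) frac_cover_eq_cover_cost[OF S] by (simp add: us_def)
  ultimately show "\<exists>f. (\<forall>i. 0 \<le> f i) \<and> (\<forall>T\<subseteq>A. sum f T \<le> frac_cover A v T) \<and>
      sum f S = frac_cover A v S" using f0 by blast
qed

end

section \<open>Truthfulness and budget feasibility\<close>

lemma valid_bids_upd: "valid_bids A B b \<Longrightarrow> 0 \<le> x \<Longrightarrow> x \<le> B \<Longrightarrow> valid_bids A B (b(i := x))"
  by (auto simp: valid_bids_def)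

text \<open>Truthfulness forbids a higher payment at the winning bid \<open>x\<close> than at
  \<open>b i\<close>, and a winner bidding \<open>x\<close> is paid at least \<open>x\<close>. Thus
  a threshold never exceeds the payment of a truthful mechanism.\<close>

lemma truthful_winning_bid_le_payment:
  assumes "is_mech A B m" "truthful A B m" "valid_bids A B b" "i \<in> A" "0 \<le> x" "x \<le> B"
    and "i \<in> fst (m b)" "i \<in> fst (m (b(i := x)))"
  shows "x \<le> snd (m b) i"
proof -
  have "utility i (b i) (m (b(i := x))) \<le> utility i (b i) (m b)"
    using assms unfolding truthful_def by blast
  moreover have "(b(i := x)) i \<le> snd (m (b(i := x))) i"
    using assms valid_bids_upd[OF assms(3,5,6)] unfolding is_mech_def by blast
  ultimately show ?thesis using assms by (simp add: utility_def)
qed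

text \<open>An agent with cost \<open>x\<close> who loses at \<open>x\<close> would gain by bidding
  \<open>b i > x\<close>, where it wins and is paid at least \<open>b i\<close>.\<close>

lemma truthful_imp_monotone:
  assumes "is_mech A B m" "truthful A B m" "valid_bids A B b" "i \<in> A" "0 \<le> x" "x \<le> b i"
    and win: "i \<in> fst (m b)"
  shows "i \<in> fst (m (b(i := x)))"
proof (rule ccontr)
  assume lose: "i \<notin> fst (m (b(i := x)))"
  have bi: "0 \<le> b i" "b i \<le> B" using assms by (auto simp: valid_bids_def)
  have "x \<noteq> b i" using lose win by auto
  then have "x < b i" using assms by simp
  have "valid_bids A B (b(i := x))" using assms bi by (intro valid_bids_upd) auto
  then have "utility i ((b(i := x)) i) (m ((b(i := x))(i := b i))) \<le> utility i ((b(i := x)) i) (m (b(i := x)))"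
    using assms bi unfolding truthful_def by blast
  then have "snd (m b) i \<le> x" using lose win by (simp add: utility_def)
  moreover have "b i \<le> snd (m b) i" using assms unfolding is_mech_def by blast
  ultimately show False using \<open>x < b i\<close> by simp
qed

lemma is_mech_thr_mech:
  assumes "\<And>b. valid_bids A B b \<Longrightarrow> alloc b \<subseteq> A"
  shows "is_mech A B (thr_mech B alloc)"
proof -
  have "b i \<le> Sup {x. 0 \<le> x \<and> x \<le> B \<and> i \<in> alloc (b(i := x))}"
    if "valid_bids A B b" "i \<in> A" "i \<in> alloc b" for b i
    using that by (intro cSup_upper bdd_aboveI[where M = B]) (auto simp: valid_bids_def)
  then show ?thesis using assms by (auto simp: is_mech_def thr_mech_def)
qed

text \<open>The threshold \<open>Sup W\<close> depends only on the bids of the others. A winner's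
  cost is at most \<open>Sup W\<close>; if a loser could win with another bid, monotonicity puts
  every winning bid, hence \<open>Sup W\<close>, below its cost.\<close>

lemma truthful_thr_mech:
  assumes mono: "\<And>b i x. valid_bids A B b \<Longrightarrow> i \<in> A \<Longrightarrow> 0 \<le> x \<Longrightarrow> x \<le> b i \<Longrightarrow>
    i \<in> alloc b \<Longrightarrow> i \<in> alloc (b(i := x))"
  shows "truthful A B (thr_mech B alloc)"
  unfolding truthful_def
proof (intro allI impI)
  fix b i x assume b: "valid_bids A B b" "i \<in> A" and x: "0 \<le> (x::real)" "x \<le> B"
  define W where "W = {y. 0 \<le> y \<and> y \<le> B \<and> i \<in> alloc (b(i := y))}"
  have bi: "0 \<le> b i" "b i \<le> B" using b by (auto simp: valid_bids_def)
  have bdd: "bdd_above W" by (rule bdd_aboveI[where M = B]) (simp add: W_def)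
  have win: "b i \<le> Sup W" if "i \<in> alloc b"
    using that bi by (intro cSup_upper bdd) (simp add: W_def)
  have lose: "Sup W \<le> b i" if l: "i \<notin> alloc b" and w: "i \<in> alloc (b(i := x))"
  proof (rule cSup_least)
    show "W \<noteq> {}" using w x by (auto simp: W_def)
    fix y assume y: "y \<in> W"
    show "y \<le> b i"
    proof (rule ccontr)
      assume "\<not> y \<le> b i"
      then have "i \<in> alloc ((b(i := y))(i := b i))"
        using mono[of "b(i := y)" i "b i"] valid_bids_upd[OF b(1), of y i] y b(2) bi
        by (simp add: W_def)
      then show False using l by simp
    qed
  qed
  have "utility i (b i) (thr_mech B alloc (b(i := x))) = (if i \<in> alloc (b(i := x)) then Sup W - b i else 0)"
    "utility i (b i) (thr_mech B alloc b) = (if i \<in> alloc b then Sup W - b i else 0)"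
    by (simp_all add: utility_def thr_mech_def W_def)
  then show "utility i (b i) (thr_mech B alloc (b(i := x))) \<le> utility i (b i) (thr_mech B alloc b)"
    using win lose by auto
qed

text \<open>The reference payments \<open>pay\<close> dominate the thresholds agent by agent, so
  their budget bound carries over. They will be the payments of AddM on the demanded set.\<close>

lemma budget_feasible_thr_mech:
  assumes "\<And>b. valid_bids A B b \<Longrightarrow> (\<Sum>i\<in>A. pay b i) \<le> B"
    and "\<And>b i. valid_bids A B b \<Longrightarrow> i \<in> A \<Longrightarrow> i \<notin> alloc b \<Longrightarrow> 0 \<le> pay b i"
    and "\<And>b i x. valid_bids A B b \<Longrightarrow> i \<in> A \<Longrightarrow> 0 \<le> x \<Longrightarrow> x \<le> B \<Longrightarrow> i \<in> alloc b \<Longrightarrow>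
      i \<in> alloc (b(i := x)) \<Longrightarrow> x \<le> pay b i"
  shows "budget_feasible A B (thr_mech B alloc)"
  unfolding budget_feasible_def
proof (intro allI impI)
  fix b assume b: "valid_bids A B b"
  have "snd (thr_mech B alloc b) i \<le> pay b i" if i: "i \<in> A" for i
  proof (cases "i \<in> alloc b")
    case True
    have "b i \<in> {x. 0 \<le> x \<and> x \<le> B \<and> i \<in> alloc (b(i := x))}"
      using b i True by (auto simp: valid_bids_def)
    then have "Sup {x. 0 \<le> x \<and> x \<le> B \<and> i \<in> alloc (b(i := x))} \<le> pay b i"
      using assms(3)[OF b i _ _ True] by (intro cSup_least) auto
    then show ?thesis using True by (simp add: thr_mech_def)
  next
    case False
    then show ?thesis using assms(2)[OF b i] by (simp add: thr_mech_def)
  qed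
  then have "(\<Sum>i\<in>A. snd (thr_mech B alloc b) i) \<le> (\<Sum>i\<in>A. pay b i)" by (rule sum_mono)
  then show "(\<Sum>i\<in>A. snd (thr_mech B alloc b) i) \<le> B" using assms(1)[OF b] by simp
qed

section \<open>The mechanism for an XOS valuation\<close>

locale xos_procurement =
  fixes A :: "nat set" and B :: real and w :: "nat set \<Rightarrow> real" and prio :: "nat set \<Rightarrow> nat"
    and addm :: "(nat \<Rightarrow> real) \<Rightarrow> nat set \<Rightarrow> mech pmf"
  assumes fin: "finite A" and ne: "A \<noteq> {}" and Bpos: "0 < B" and xos: "xos_on A w"
    and prio: "inj_on prio (Pow A)" and addm: "addm_ok A B addm"
begin

lemma supporting_additive:
  assumes "S \<subseteq> A"
  obtains f where "\<And>i. 0 \<le> f i" "\<And>T. T \<subseteq> A \<Longrightarrow> sum f T \<le> w T" "sum f S = w S"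
  using xos assms unfolding xos_on_def by metis

text \<open>\<open>xos_on\<close> provides exactly the witness that the choice operator in
  \<open>xos_supp\<close> asks for.\<close>

lemma xos_supp:
  assumes "S \<subseteq> A"
  shows "0 \<le> xos_supp A w S i" "T \<subseteq> A \<Longrightarrow> sum (xos_supp A w S) T \<le> w T"
    "sum (xos_supp A w S) S = w S"
proof -
  have "\<exists>f. (\<forall>i. 0 \<le> f i) \<and> (\<forall>T\<subseteq>A. sum f T \<le> w T) \<and> sum f S = w S"
    using xos assms by (auto simp: xos_on_def)
  from someI_ex[OF this, folded xos_supp_def]
  show "0 \<le> xos_supp A w S i" "T \<subseteq> A \<Longrightarrow> sum (xos_supp A w S) T \<le> w T"
    "sum (xos_supp A w S) S = w S" by auto
qed

lemma w_nonneg: "S \<subseteq> A \<Longrightarrow> 0 \<le> w S"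
  using xos_supp(1,3)[of S] by (metis sum_nonneg)

lemma w_empty: "w {} = 0"
  using xos_supp(3)[of "{}"] by simp

lemma w_mono: assumes "S \<subseteq> T" "T \<subseteq> A" shows "w S \<le> w T"
proof -
  have "w S = sum (xos_supp A w S) S" using assms xos_supp(3)[of S] by auto
  also have "\<dots> \<le> sum (xos_supp A w S) T"
    using assms fin xos_supp(1)[of S] by (intro sum_mono2) (auto intro: finite_subset)
  also have "\<dots> \<le> w T" using assms xos_supp(2)[of S T] by auto
  finally show ?thesis .
qed

lemma addm_mech:
  assumes "S \<subseteq> A" "m \<in> set_pmf (addm (xos_supp A w S) S)"
  shows "is_mech A B m" "truthful A B m" "budget_feasible A B m"
    "valid_bids A B b \<Longrightarrow> fst (m b) \<subseteq> S"
  using addm assms xos_supp(1)[of S] unfolding addm_ok_def by blast+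

lemma addm_approx:
  assumes "S \<subseteq> A" "valid_bids A B c" "S' \<subseteq> S" "sum c S' \<le> B"
  shows "sum (xos_supp A w S) S' \<le>
    3 * measure_pmf.expectation (addm (xos_supp A w S) S) (\<lambda>m. sum (xos_supp A w S) (fst (m c)))"
proof -
  have "finite S" using assms fin finite_subset by blast
  then have "sum (xos_supp A w S) S' \<le> Max (sum (xos_supp A w S) ` {S'. S' \<subseteq> S \<and> sum c S' \<le> B})"
    using assms by (intro Max_ge) auto
  also have "\<dots> \<le> 3 * measure_pmf.expectation (addm (xos_supp A w S) S) (\<lambda>m. sum (xos_supp A w S) (fst (m c)))"
    using addm assms xos_supp(1)[of S] unfolding addm_ok_def by blast
  finally show ?thesis .
qed

lemma xos_topt_ge:
  assumes "T \<subseteq> A" "S \<subseteq> T" "sum b S \<le> B" shows "w S \<le> xos_topt B w T b"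
  unfolding xos_topt_def using assms fin finite_subset[of T A] by (intro Max_ge) auto

lemma xos_topt_nonneg: "T \<subseteq> A \<Longrightarrow> 0 \<le> xos_topt B w T b"
  using xos_topt_ge[of T "{}" b] w_empty Bpos by simp

text \<open>The price \<open>t\<close> is computed from sampled agents alone, so no candidate winner
  can influence it.\<close>

lemma xos_topt_upd: "i \<notin> T \<Longrightarrow> xos_topt B w T (b(i := x)) = xos_topt B w T b"
proof -
  assume "i \<notin> T"
  then have "sum (b(i := x)) S = sum b S" if "S \<subseteq> T" for S
    using that by (intro sum.cong) auto
  then have "{S. S \<subseteq> T \<and> sum (b(i := x)) S \<le> B} = {S. S \<subseteq> T \<and> sum b S \<le> B}" by auto
  then show ?thesis by (simp add: xos_topt_def)
qed

text \<open>The family \<open>M\<close> inside \<open>sstar\<close> with the price written out;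
  \<open>sstar\<close> is its member of least \<open>prio\<close>.\<close>

definition demand :: "nat set \<Rightarrow> bids \<Rightarrow> nat set set" where
  "demand T b = {S\<in>Pow (A - T). \<forall>S'\<in>Pow (A - T).
     w S' - xos_topt B w T b / (8 * B) * sum b S' \<le> w S - xos_topt B w T b / (8 * B) * sum b S}"

lemma sstar_demand:
  "sstar A B w prio T b \<in> demand T b"
  "S \<in> demand T b \<Longrightarrow> prio (sstar A B w prio T b) \<le> prio S"
proof -
  have eq: "sstar A B w prio T b = (SOME S. S \<in> demand T b \<and> (\<forall>S'\<in>demand T b. prio S \<le> prio S'))"
    by (simp add: sstar_def demand_def Let_def)
  define g where "g S = w S - xos_topt B w T b / (8 * B) * sum b S" for S
  have "finite (g ` Pow (A - T))" "g ` Pow (A - T) \<noteq> {}" using fin by auto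
  then have "Max (g ` Pow (A - T)) \<in> g ` Pow (A - T)" by (rule Max_in)
  then obtain S0 where S0: "S0 \<in> Pow (A - T)" "Max (g ` Pow (A - T)) = g S0" by blast
  have "g S' \<le> g S0" if "S' \<in> Pow (A - T)" for S'
    using that fin unfolding S0(2)[symmetric] by (intro Max_ge) auto
  then have "S0 \<in> demand T b" using S0 by (auto simp: demand_def g_def)
  then have "\<exists>S. S \<in> demand T b \<and> (\<forall>S'\<in>demand T b. prio S \<le> prio S')"
    using ex_has_least_nat[of "\<lambda>S. S \<in> demand T b" S0 prio] by blast
  from someI_ex[OF this, folded eq]
  show "sstar A B w prio T b \<in> demand T b"
    "S \<in> demand T b \<Longrightarrow> prio (sstar A B w prio T b) \<le> prio S" by auto
qed

lemma sstar_subset: "sstar A B w prio T b \<subseteq> A - T"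
  using sstar_demand(1)[of T b] by (auto simp: demand_def)

lemma sstar_optimal:
  "S \<subseteq> A - T \<Longrightarrow> w S - xos_topt B w T b / (8 * B) * sum b S
    \<le> w (sstar A B w prio T b) - xos_topt B w T b / (8 * B) * sum b (sstar A B w prio T b)"
  using sstar_demand(1)[of T b] by (auto simp: demand_def)

text \<open>Lowering the bid of \<open>i\<close> raises the objective of every set containing \<open>i\<close> by the same
  amount, so a selected set containing \<open>i\<close> stays selected.\<close>

lemma sstar_lower_bid:
  assumes T: "T \<subseteq> A" and i: "i \<in> sstar A B w prio T b" and x: "x \<le> b i"
  shows "sstar A B w prio T (b(i := x)) = sstar A B w prio T b"
proof -
  let ?S = "sstar A B w prio T b" and ?b = "b(i := x)"
  have iT: "i \<in> A - T" using i sstar_subset by blast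
  define t where "t = xos_topt B w T b / (8 * B)"
  have t: "0 \<le> t" "xos_topt B w T ?b / (8 * B) = t"
    using xos_topt_nonneg[OF T] xos_topt_upd[of i T] Bpos iT by (auto simp: t_def)
  define \<delta> where "\<delta> S = (if i \<in> S then t * (b i - x) else 0)" for S
  have \<delta>: "\<delta> S \<le> \<delta> ?S" for S using t x i by (auto simp: \<delta>_def)
  have eq: "w S - t * sum ?b S = w S - t * sum b S + \<delta> S" if "S \<subseteq> A - T" for S
  proof (cases "i \<in> S")
    case True
    have "finite S" using that fin finite_subset by blast
    then have "sum ?b S = x + sum b (S - {i})" "sum b S = b i + sum b (S - {i})"
      using True by (simp_all add: sum.remove[of S i])
    then show ?thesis using True by (simp add: \<delta>_def algebra_simps)
  next
    case False
    then have "sum ?b S = sum b S" by (intro sum.cong) auto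
    then show ?thesis using False by (simp add: \<delta>_def)
  qed
  have opt: "w S - t * sum b S \<le> w ?S - t * sum b ?S" if "S \<subseteq> A - T" for S
    using sstar_optimal[OF that, of b] by (simp add: t_def)
  have in1: "?S \<in> demand T ?b"
  proof -
    have "w S - t * sum ?b S \<le> w ?S - t * sum ?b ?S" if "S \<subseteq> A - T" for S
      unfolding eq[OF that] eq[OF sstar_subset] using opt[OF that] \<delta>[of S] by simp
    then show ?thesis using sstar_subset[of T b] by (simp add: demand_def t(2))
  qed
  \<comment> \<open>Conversely nothing new becomes optimal: a set optimal at the lowered bid gained
    at most as much as \<open>?S\<close>, so it was already optimal before.\<close>
  have in2: "S \<in> demand T b" if S: "S \<in> demand T ?b" for S
  proof -
    have sub: "S \<subseteq> A - T" using S by (auto simp: demand_def)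
    have "w ?S - t * sum ?b ?S \<le> w S - t * sum ?b S"
      using S sstar_subset[of T b] by (simp add: demand_def t(2))
    then have "w ?S - t * sum b ?S \<le> w S - t * sum b S"
      unfolding eq[OF sub] eq[OF sstar_subset] using \<delta>[of S] by simp
    then have "\<forall>S'\<in>Pow (A - T). w S' - t * sum b S' \<le> w S - t * sum b S"
      using opt order_trans by blast
    then show ?thesis using sub by (simp add: demand_def t_def)
  qed
  \<comment> \<open>Each selected set belongs to the other demand family, so minimality gives equal
    priorities, and injectivity of \<open>prio\<close> gives equal sets.\<close>
  have "prio (sstar A B w prio T ?b) = prio ?S"
    using sstar_demand(2)[OF in1] sstar_demand(2)[OF in2[OF sstar_demand(1)]] by (rule antisym)
  moreover have "sstar A B w prio T b' \<in> Pow A" for b' using sstar_subset[of T b'] by blast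
  ultimately show ?thesis using prio by (meson inj_onD)
qed

text \<open>Here the sample and one AddM realisation \<open>mf S\<close> per candidate set are
  fixed. Every winner lies in the demanded set, which lowering its bid leaves unchanged, so the
  properties of the single mechanism \<open>mf (?s b)\<close> transfer.\<close>

lemma thr_mech_xos_random_sample:
  assumes T: "T \<subseteq> A"
    and mf: "\<And>S. S \<subseteq> A - T \<Longrightarrow> mf S \<in> set_pmf (addm (xos_supp A w S) S)"
  defines "m \<equiv> thr_mech B (\<lambda>b. fst (mf (sstar A B w prio T b) b))"
  shows "is_mech A B m" "truthful A B m" "budget_feasible A B m"
proof -
  let ?s = "sstar A B w prio T"
  have sA: "?s b \<subseteq> A" for b using sstar_subset by blast
  note M = addm_mech[OF sA mf[OF sstar_subset]]
  have win_s: "i \<in> ?s b" if "valid_bids A B b" "i \<in> fst (mf (?s b) b)" for b i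
    using M(4)[OF that(1)] that(2) by blast
  show "is_mech A B m" unfolding m_def
    using M(4) sA by (intro is_mech_thr_mech) blast
  show "truthful A B m" unfolding m_def
  proof (rule truthful_thr_mech)
    fix b i x assume b: "valid_bids A B b" "i \<in> A" "0 \<le> x" "x \<le> b i" "i \<in> fst (mf (?s b) b)"
    show "i \<in> fst (mf (?s (b(i := x))) (b(i := x)))"
      unfolding sstar_lower_bid[OF T win_s[OF b(1,5)] b(4)]
      by (rule truthful_imp_monotone[OF M(1,2) b])
  qed
  show "budget_feasible A B m" unfolding m_def
  proof (rule budget_feasible_thr_mech[where pay = "\<lambda>b. snd (mf (?s b) b)"])
    fix b assume b: "valid_bids A B b"
    show "(\<Sum>i\<in>A. snd (mf (?s b) b) i) \<le> B" using M(3) b by (auto simp: budget_feasible_def)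
    fix i assume i: "i \<in> A"
    show "0 \<le> snd (mf (?s b) b) i" if "i \<notin> fst (mf (?s b) b)"
      using M(1) b i that by (simp add: is_mech_def)
    fix x assume x: "0 \<le> x" "x \<le> B" "i \<in> fst (mf (?s b) b)"
      and x': "i \<in> fst (mf (?s (b(i := x))) (b(i := x)))"
    have "?s (b(i := x)) = ?s b"
    proof (cases "x \<le> b i")
      case True
      then show ?thesis by (intro sstar_lower_bid T win_s b x)
    next
      \<comment> \<open>Now \<open>b i\<close> is the lower of two winning bids, so the invariance
        is applied starting from \<open>b(i := x)\<close>.\<close>
      case False
      have "i \<in> ?s (b(i := x))" using b x x' by (intro win_s valid_bids_upd)
      from sstar_lower_bid[OF T this, of "b i"] False show ?thesis by simp
    qed
    then have "i \<in> fst (mf (?s b) (b(i := x)))" using x' by simp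
    then show "x \<le> snd (mf (?s b) b) i"
      by (rule truthful_winning_bid_le_payment[OF M(1,2) b i x])
  qed
qed

lemma max_item:
  obtains i where "i \<in> A" "\<And>j. j \<in> A \<Longrightarrow> w {j} \<le> w {i}"
    "max_item_mech A B w = (\<lambda>b. ({i}, \<lambda>j. if j = i then B else 0))"
proof -
  define i where "i = (SOME i. i \<in> A \<and> (\<forall>j\<in>A. w {j} \<le> w {i}))"
  have "Max ((\<lambda>i. w {i}) ` A) \<in> (\<lambda>i. w {i}) ` A" using fin ne by (intro Max_in) auto
  then obtain k where k: "k \<in> A" "Max ((\<lambda>i. w {i}) ` A) = w {k}" by blast
  have "w {j} \<le> w {k}" if "j \<in> A" for j
    using that fin unfolding k(2)[symmetric] by (intro Max_ge) auto
  then have "\<exists>i. i \<in> A \<and> (\<forall>j\<in>A. w {j} \<le> w {i})" using k by blast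
  from someI_ex[OF this, folded i_def]
  show ?thesis by (intro that[of i]) (auto simp: max_item_mech_def i_def Let_def)
qed

lemma max_item_mech:
  "is_mech A B (max_item_mech A B w)" "truthful A B (max_item_mech A B w)"
  "budget_feasible A B (max_item_mech A B w)"
proof -
  obtain i where i: "i \<in> A" "max_item_mech A B w = (\<lambda>b. ({i}, \<lambda>j. if j = i then B else 0))"
    using max_item by blast
  show "is_mech A B (max_item_mech A B w)" using i by (auto simp: is_mech_def valid_bids_def)
  show "truthful A B (max_item_mech A B w)" using i by (auto simp: truthful_def utility_def)
  show "budget_feasible A B (max_item_mech A B w)"
    using i fin by (auto simp: budget_feasible_def sum.delta)
qed

lemma xos_random_sample_cases:
  assumes "m \<in> set_pmf (xos_random_sample A B w prio addm)"
  obtains T mf where "T \<subseteq> A" "\<And>S. S \<subseteq> A - T \<Longrightarrow> mf S \<in> set_pmf (addm (xos_supp A w S) S)"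
    "m = thr_mech B (\<lambda>b. fst (mf (sstar A B w prio T b) b))"
proof -
  from assms obtain g mf where
    mf: "mf \<in> set_pmf (Pi_pmf (Pow (A - {i\<in>A. g i})) null_mech (\<lambda>S. addm (xos_supp A w S) S))"
    and m: "m = thr_mech B (\<lambda>b. fst (mf (sstar A B w prio {i\<in>A. g i} b) b))"
    by (auto simp: xos_random_sample_def Let_def)
  have "mf S \<in> set_pmf (addm (xos_supp A w S) S)" if "S \<subseteq> A - {i\<in>A. g i}" for S
    using mf that fin by (subst (asm) set_Pi_pmf) (auto simp: PiE_dflt_def)
  then show ?thesis using m by (intro that[of "{i\<in>A. g i}" mf]) auto
qed

lemma xos_main_mech:
  assumes "m \<in> set_pmf (xos_main A B w prio addm)"
  shows "is_mech A B m" "truthful A B m" "budget_feasible A B m"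
proof -
  consider "m \<in> set_pmf (xos_random_sample A B w prio addm)" | "m = max_item_mech A B w"
    using assms by (auto simp: xos_main_def split: if_splits)
  then have "is_mech A B m \<and> truthful A B m \<and> budget_feasible A B m"
  proof cases
    case 1
    then show ?thesis
      by (elim xos_random_sample_cases) (simp add: thr_mech_xos_random_sample)
  next
    case 2
    then show ?thesis using max_item_mech by simp
  qed
  then show "is_mech A B m" "truthful A B m" "budget_feasible A B m" by auto
qed

end

section \<open>Approximation ratio\<close>

lemma integrable_pmf_bounded:
  fixes h :: "'a \<Rightarrow> real"
  assumes "\<And>y. y \<in> set_pmf p \<Longrightarrow> \<bar>h y\<bar> \<le> K"
  shows "integrable (measure_pmf p) h"
  using assms by (intro measure_pmf.integrable_const_bound[where B = K]) (auto simp: AE_measure_pmf_iff)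

lemma expectation_mono_pmf:
  fixes h k :: "'a \<Rightarrow> real"
  assumes "\<And>y. y \<in> set_pmf p \<Longrightarrow> \<bar>h y\<bar> \<le> K" "\<And>y. y \<in> set_pmf p \<Longrightarrow> \<bar>k y\<bar> \<le> L"
    "\<And>y. y \<in> set_pmf p \<Longrightarrow> h y \<le> k y"
  shows "measure_pmf.expectation p h \<le> measure_pmf.expectation p k"
  using assms by (intro integral_mono_AE integrable_pmf_bounded[where K = K]
    integrable_pmf_bounded[where K = L]) (auto simp: AE_measure_pmf_iff)

lemma nn_integral_pmf_bounded:
  fixes h :: "'a \<Rightarrow> real"
  assumes "\<And>y. 0 \<le> h y" "\<And>y. h y \<le> K"
  shows "(\<integral>\<^sup>+y. ennreal (h y) \<partial>measure_pmf p) = ennreal (measure_pmf.expectation p h)"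
  using assms by (intro nn_integral_eq_integral integrable_pmf_bounded[where K = K]) auto

text \<open>The identity holds for nonnegative integrals; the bounds \<open>0\<close> and
  \<open>K\<close> make all expectations finite, so it can be read back in the reals.\<close>

lemma expectation_bind_pmf_bounded:
  fixes h :: "'b \<Rightarrow> real"
  assumes h: "\<And>y. 0 \<le> h y" "\<And>y. h y \<le> K"
  shows "measure_pmf.expectation (bind_pmf p q) h =
    measure_pmf.expectation p (\<lambda>x. measure_pmf.expectation (q x) h)"
proof -
  have E: "0 \<le> measure_pmf.expectation r h" "measure_pmf.expectation r h \<le> K" for r
    using h by (auto intro!: integral_nonneg_AE measure_pmf.integral_le_const
      integrable_pmf_bounded[where K = K])
  have "ennreal (measure_pmf.expectation (bind_pmf p q) h) =
      (\<integral>\<^sup>+y. ennreal (h y) \<partial>measure_pmf (bind_pmf p q))"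
    using nn_integral_pmf_bounded[of h K, OF h] by (rule sym)
  also have "\<dots> = (\<integral>\<^sup>+x. ennreal (measure_pmf.expectation (q x) h) \<partial>measure_pmf p)"
    by (subst nn_integral_bind_pmf) (simp only: nn_integral_pmf_bounded[of h K, OF h])
  also have "\<dots> = ennreal (measure_pmf.expectation p (\<lambda>x. measure_pmf.expectation (q x) h))"
    using E by (rule nn_integral_pmf_bounded)
  finally show ?thesis using E by (subst (asm) ennreal_inj) (auto intro!: integral_nonneg_AE)
qed

text \<open>The integrand is written as a product over all coordinates, with factor one away from
  \<open>i\<close> and \<open>j\<close>; independence then leaves \<open>1/2\<close> times
  \<open>1/2\<close>.\<close>

lemma expectation_split_pair:
  assumes "finite A" "i \<in> A" "j \<in> A" "i \<noteq> j"
  shows "measure_pmf.expectation (Pi_pmf A False (\<lambda>_. bernoulli_pmf (1/2)))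
    (\<lambda>g. of_bool (g i) * of_bool (\<not> g j)) = (1/4 :: real)"
proof -
  define F where "F x y = (if x = i then of_bool y else if x = j then of_bool (\<not> y) else 1 :: real)"
    for x :: 'a and y
  have A: "A = insert i (insert j (A - {i, j}))" using assms by auto
  have fin: "finite (A - {i, j})" using assms by simp
  have prod: "(\<Prod>x\<in>A. G x) = G i * G j" if "\<And>x. x \<in> A - {i, j} \<Longrightarrow> G x = 1" for G :: "'a \<Rightarrow> real"
    by (subst A) (use assms fin that in simp)
  have "(\<lambda>g. of_bool (g i) * of_bool (\<not> g j)) = (\<lambda>g. \<Prod>x\<in>A. F x (g x))"
    by (subst prod) (use assms in \<open>auto simp: F_def\<close>)
  then have "measure_pmf.expectation (Pi_pmf A False (\<lambda>_. bernoulli_pmf (1/2)))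
      (\<lambda>g. of_bool (g i) * of_bool (\<not> g j)) =
    (\<Prod>x\<in>A. measure_pmf.expectation (bernoulli_pmf (1/2)) (F x))"
    using assms(1) by (simp only:, intro expectation_prod_Pi_pmf)
      (auto simp: F_def intro!: integrable_measure_pmf_finite)
  also have "\<dots> = 1/4"
    by (subst prod) (use assms in \<open>auto simp: F_def\<close>)
  finally show ?thesis .
qed

text \<open>Expanding over ordered pairs, a diagonal pair contributes nothing because no item lies
  on both sides, and every other pair is split this way with probability \<open>1/4\<close>.\<close>

lemma expectation_split_product:
  fixes f :: "'a \<Rightarrow> real"
  assumes fin: "finite A" and S: "S \<subseteq> A"
  shows "measure_pmf.expectation (Pi_pmf A False (\<lambda>_. bernoulli_pmf (1/2)))
      (\<lambda>g. sum f (S \<inter> {i\<in>A. g i}) * sum f (S - {i\<in>A. g i})) = ((sum f S)\<^sup>2 - (\<Sum>i\<in>S. (f i)\<^sup>2)) / 4"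
    (is "measure_pmf.expectation ?P _ = _")
proof -
  have finS: "finite S" using fin S finite_subset by blast
  let ?e = "\<lambda>i j. measure_pmf.expectation ?P (\<lambda>g. of_bool (g i) * of_bool (\<not> g j)) :: real"
  have e: "?e i j = (if j = i then 0 else 1/4)" if "i \<in> S" "j \<in> S" for i j
  proof (cases "i = j")
    case True
    then have "(\<lambda>g. of_bool (g i) * of_bool (\<not> g j)) = (\<lambda>g. 0 :: real)" by auto
    then show ?thesis using True by simp
  next
    case False
    then show ?thesis using expectation_split_pair[OF fin, of i j] that S by auto
  qed
  have eq: "sum f (S \<inter> {i\<in>A. g i}) * sum f (S - {i\<in>A. g i}) =
      (\<Sum>i\<in>S. \<Sum>j\<in>S. f i * f j * (of_bool (g i) * of_bool (\<not> g j)))" for g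
  proof -
    have "S \<inter> {i\<in>A. g i} = S \<inter> {i. g i}" "S - {i\<in>A. g i} = S \<inter> {i. \<not> g i}" using S by auto
    moreover have "sum f (S \<inter> {i. Q i}) = (\<Sum>i\<in>S. f i * of_bool (Q i))" for Q
      using finS by (simp add: sum.inter_restrict of_bool_def if_distrib cong: if_cong)
    ultimately show ?thesis by (simp add: sum_product mult_ac)
  qed
  have int: "integrable (measure_pmf ?P) (\<lambda>g. f i * f j * (of_bool (g i) * of_bool (\<not> g j)))" for i j
    by (rule integrable_pmf_bounded[where K = "\<bar>f i * f j\<bar>"]) (auto simp: of_bool_def)
  have "measure_pmf.expectation ?P (\<lambda>g. sum f (S \<inter> {i\<in>A. g i}) * sum f (S - {i\<in>A. g i})) =
      (\<Sum>i\<in>S. \<Sum>j\<in>S. f i * f j * ?e i j)"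
    unfolding eq using int by (simp add: Bochner_Integration.integral_sum Bochner_Integration.integrable_sum)
  also have "\<dots> = (\<Sum>i\<in>S. \<Sum>j\<in>S. f i * f j / 4 - (if j = i then f i * f j / 4 else 0))"
    using e by (intro sum.cong refl) simp
  also have "\<dots> = ((sum f S)\<^sup>2 - (\<Sum>i\<in>S. (f i)\<^sup>2)) / 4"
    using finS by (simp add: sum_subtractf sum.delta' sum_product power2_eq_square
      sum_divide_distrib diff_divide_distrib)
  finally show ?thesis .
qed

section \<open>The value obtained from a fixed sample, and its average\<close>

lemma subset_sum_half_budget:
  fixes c :: "'a \<Rightarrow> real"
  assumes "finite S" "\<And>i. i \<in> S \<Longrightarrow> c i \<le> B" "B < sum c S" "0 < B"
  shows "\<exists>S'\<subseteq>S. B / 2 \<le> sum c S' \<and> sum c S' \<le> B"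
  using assms
proof (induction S)
  case empty
  then show ?case by simp
next
  case (insert i S)
  show ?case
  proof (cases "B < sum c S")
    case True
    then show ?thesis using insert by (metis insert_iff subset_insertI2)
  next
    case False
    \<comment> \<open>Each of \<open>S\<close> and \<open>{i}\<close> fits the budget, while
      together they exceed it, so one of them costs at least half of it.\<close>
    then have "B / 2 \<le> sum c S \<or> B / 2 \<le> sum c {i}" using insert by auto
    then show ?thesis using False insert.prems(1)[of i]
      by (elim disjE) (auto intro: exI[of _ S] exI[of _ "{i}"])
  qed
qed

text \<open>The left-hand side is \<open>(X - F / 8) (Y - F / 8) / (18 F)\<close>: a quadratic minorant of the value
  obtained from one sample, whose expectation needs pairwise independence only.\<close>

lemma split_product_bound:
  fixes F X Y :: real
  assumes "0 < F" "0 \<le> X" "0 \<le> Y" "X + Y = F" and z: "0 \<le> z" "Y - F / 8 \<le> z \<or> X / 16 \<le> z"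
  shows "(X * Y / F - 7 / 64 * F) / 18 \<le> z"
proof -
  \<comment> \<open>With \<open>X + Y = F\<close> the product expands to
    \<open>X Y - F^2 / 8 + F^2 / 64\<close>, the origin of \<open>7 / 64\<close>.\<close>
  have eq: "X * Y - 7 / 64 * F\<^sup>2 = (X - F / 8) * (Y - F / 8)"
    unfolding assms(4)[symmetric] by (simp add: power2_eq_square field_simps)
  have "(X - F / 8) * (Y - F / 8) \<le> 18 * z * F"
  \<comment> \<open>If both factors are nonnegative, each is at most \<open>F\<close>, and one of
    them is at most \<open>z\<close> or \<open>16 z\<close>. Otherwise just one is negative, since
    \<open>X + Y = F\<close>.\<close>
  proof (cases "F / 8 \<le> X \<and> F / 8 \<le> Y")
    case True
    from z(2) show ?thesis
    proof
      assume *: "Y - F / 8 \<le> z"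
      have "(X - F / 8) * (Y - F / 8) \<le> F * z" using True * assms by (intro mult_mono) auto
      also have "\<dots> \<le> 18 * z * F" using assms by (simp add: mult.commute)
      finally show ?thesis .
    next
      assume *: "X / 16 \<le> z"
      have "(X - F / 8) * (Y - F / 8) \<le> (16 * z) * F" using True * assms by (intro mult_mono) auto
      also have "\<dots> \<le> 18 * z * F" using assms by (intro mult_right_mono) auto
      finally show ?thesis .
    qed
  next
    case False
    then have "(X - F / 8) * (Y - F / 8) \<le> 0"
      using assms by (auto simp: mult_le_0_iff)
    also have "0 \<le> 18 * z * F" using assms by simp
    finally show ?thesis .
  qed
  then show ?thesis unfolding eq[symmetric] using assms(1)
    by (simp add: field_simps power2_eq_square)
qed

context xos_procurement
begin

text \<open>Supplies the affordable subset of the demanded set against which AddM is measured. An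
  affordable \<open>s\<close> is compared with \<open>S - T\<close> by utility; an unaffordable one
  is cut down to a part of cost at least \<open>B / 2\<close>, whose price is at least
  \<open>W / 16\<close>.\<close>

lemma sstar_affordable_subset:
  assumes T: "T \<subseteq> A" and c: "valid_bids A B c" and S: "S \<subseteq> A" "sum c S \<le> B"
    and opt: "xos_topt B w T c \<le> w S" "0 < w S"
    and f: "\<And>i. 0 \<le> f i" "\<And>T. T \<subseteq> A \<Longrightarrow> sum f T \<le> w T" "sum f S = w S"
  defines "s \<equiv> sstar A B w prio T c"
  obtains S' where "S' \<subseteq> s" "sum c S' \<le> B"
    "(sum f (S \<inter> T) * sum f (S - T) / w S - 7 / 64 * w S) / 18 \<le> sum (xos_supp A w s) S'"
proof -
  define W where "W = xos_topt B w T c"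
  define t where "t = W / (8 * B)"
  have sA: "s \<subseteq> A - T" "s \<subseteq> A" using sstar_subset by (auto simp: s_def)
  have finA: "finite U" if "U \<subseteq> A" for U using that fin finite_subset by blast
  have c0: "0 \<le> c i" "c i \<le> B" if "i \<in> A" for i using c that by (auto simp: valid_bids_def)
  have cmono: "sum c U \<le> sum c V" if "U \<subseteq> V" "V \<subseteq> A" for U V
    using that finA c0 by (intro sum_mono2) auto
  have W0: "0 \<le> W" and WS: "W \<le> w S"
    using xos_topt_nonneg[OF T] opt by (auto simp: W_def)
  have t0: "0 \<le> t" and tB: "t * B = W / 8" using W0 Bpos by (auto simp: t_def)
  \<comment> \<open>\<open>S \<inter> T\<close> is affordable and hence competes for the sample
    optimum.\<close>
  have X: "sum f (S \<inter> T) \<le> W"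
  proof -
    have "sum f (S \<inter> T) \<le> w (S \<inter> T)" using f(2)[of "S \<inter> T"] S by auto
    also have "\<dots> \<le> W" unfolding W_def
      using cmono[of "S \<inter> T" S] S T by (intro xos_topt_ge) auto
    finally show ?thesis .
  qed
  have XY: "sum f (S \<inter> T) + sum f (S - T) = w S"
    using f(3) finA[OF S(1)] by (metis sum.Int_Diff)
  have sopt: "w U - t * sum c U \<le> w s - t * sum c s" if "U \<subseteq> A - T" for U
    using sstar_optimal[OF that, of c] by (simp add: s_def t_def W_def)
  note fs = xos_supp[OF sA(2)]
  have nonneg: "0 \<le> sum (xos_supp A w s) S'" for S' using fs(1) by (simp add: sum_nonneg)
  have goal: "(sum f (S \<inter> T) * sum f (S - T) / w S - 7 / 64 * w S) / 18 \<le> sum (xos_supp A w s) S'"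
    if "sum f (S - T) - w S / 8 \<le> sum (xos_supp A w s) S' \<or>
      sum f (S \<inter> T) / 16 \<le> sum (xos_supp A w s) S'" for S'
    using that nonneg opt(2) XY f(1) by (intro split_product_bound) (auto simp: sum_nonneg)
  show ?thesis
  proof (cases "sum c s \<le> B")
    case True
    \<comment> \<open>The whole budget priced at \<open>t\<close> amounts to \<open>W / 8\<close>,
      which is at most \<open>w S / 8\<close>.\<close>
    have "sum f (S - T) - w S / 8 \<le> w (S - T) - t * B" using f(2)[of "S - T"] S(1) tB WS by fastforce
    also have "\<dots> \<le> w (S - T) - t * sum c (S - T)"
      using t0 S cmono[of "S - T" S] by (auto intro!: mult_left_mono)
    also have "\<dots> \<le> w s - t * sum c s" using S by (intro sopt) auto
    also have "\<dots> \<le> w s" using t0 c0 sA by (auto intro!: mult_nonneg_nonneg sum_nonneg)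
    finally show ?thesis using fs(3) True by (intro that[of s] goal) auto
  next
    case False
    then obtain S' where S': "S' \<subseteq> s" "B / 2 \<le> sum c S'" "sum c S' \<le> B"
      using subset_sum_half_budget[OF finA[OF sA(2)], of c B] sA(2) c0(2) Bpos by force
    have sum_diff: "sum g s = sum g S' + sum g (s - S')" for g :: "nat \<Rightarrow> real"
      using S'(1) finA[OF sA(2)] by (metis add.commute sum.subset_diff)
    have "sum f (S \<inter> T) / 16 \<le> W / 16" using X by simp
    also have "\<dots> = t * (B / 2)" using tB by simp
    also have "\<dots> \<le> t * sum c S'" using t0 S' by (intro mult_left_mono)
    \<comment> \<open>dropping \<open>S'\<close> from the demanded set does not improve its utility\<close>
    also have "\<dots> \<le> sum (xos_supp A w s) S'"
    proof -
      have "sum (xos_supp A w s) (s - S') \<le> w (s - S')" using fs(2)[of "s - S'"] sA by auto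
      moreover have "w (s - S') - t * sum c (s - S') \<le> w s - t * sum c s"
        using sA by (intro sopt) auto
      ultimately show ?thesis
        using fs(3) sum_diff[of c] sum_diff[of "xos_supp A w s"] by (simp add: algebra_simps)
    qed
    finally show ?thesis using S' by (intro that[of S'] goal) auto
  qed
qed

text \<open>Intersecting with \<open>A\<close> bounds the value for every mechanism, also outside
  the support, as \<open>expectation_bind_pmf_bounded\<close> requires. On the support the winners
  lie in \<open>A\<close> anyway.\<close>

lemma restricted_value_bounds: "0 \<le> w (S \<inter> A)" "w (S \<inter> A) \<le> w A"
  using w_nonneg w_mono by auto

text \<open>The quadratic bound holds for each sample and is then averaged. The divisor
  \<open>54\<close> is \<open>18\<close> from \<open>split_product_bound\<close> times the ratio
  \<open>3\<close> of AddM.\<close>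

lemma xos_random_sample_expectation_ge:
  assumes c: "valid_bids A B c" and S: "S \<subseteq> A" "sum c S \<le> B" "w S = opt_val A B w c" "0 < w S"
    and f: "\<And>i. 0 \<le> f i" "\<And>T. T \<subseteq> A \<Longrightarrow> sum f T \<le> w T" "sum f S = w S"
  shows "(((w S)\<^sup>2 - (\<Sum>i\<in>S. (f i)\<^sup>2)) / (4 * w S) - 7 / 64 * w S) / 54 \<le>
    measure_pmf.expectation (xos_random_sample A B w prio addm) (\<lambda>m. w (fst (m c) \<inter> A))"
proof -
  define P where "P = Pi_pmf A False (\<lambda>_. bernoulli_pmf (1/2))"
  define s where "s g = sstar A B w prio {i\<in>A. g i} c" for g
  define E where "E g = measure_pmf.expectation (addm (xos_supp A w (s g)) (s g))
    (\<lambda>m. w (fst (m c) \<inter> A))" for g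
  define Z where "Z g = sum f (S \<inter> {i\<in>A. g i}) * sum f (S - {i\<in>A. g i})" for g
  have s: "s g \<subseteq> A - {i\<in>A. g i}" for g using sstar_subset by (simp add: s_def)
  have finS: "finite S" using S fin finite_subset by blast
  have E: "measure_pmf.expectation (xos_random_sample A B w prio addm) (\<lambda>m. w (fst (m c) \<inter> A)) =
      measure_pmf.expectation P E"
  proof -
    have "measure_pmf.expectation (Pi_pmf (Pow (A - {i\<in>A. g i})) null_mech
        (\<lambda>S. addm (xos_supp A w S) S)) (\<lambda>mf. w (fst (mf (s g) c) \<inter> A)) = E g" for g
    \<comment> \<open>For a fixed sample and fixed bids only the realisation at \<open>s g\<close>
      matters, and its marginal under the product distribution is the AddM distribution
      itself.\<close>
    proof -
      have "map_pmf (\<lambda>mf. mf (s g)) (Pi_pmf (Pow (A - {i\<in>A. g i})) null_mech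
          (\<lambda>S. addm (xos_supp A w S) S)) = addm (xos_supp A w (s g)) (s g)"
        using fin s[of g] by (subst Pi_pmf_component) auto
      then show ?thesis 
        unfolding E_def by (simp flip: \<open>map_pmf _ _ = addm (xos_supp A w (s g)) (s g)\<close>)
    qed
    then show ?thesis
      unfolding xos_random_sample_def Let_def P_def[symmetric]
      by (simp add: expectation_bind_pmf_bounded[where K = "w A"] restricted_value_bounds
        thr_mech_def s_def)
  qed
  have X0: "0 \<le> sum f U" for U using f(1) by (simp add: sum_nonneg)
  have Zb: "\<bar>Z g\<bar> \<le> w S * w S" for g
  proof -
    have "sum f (S \<inter> {i\<in>A. g i}) \<le> w S" "sum f (S - {i\<in>A. g i}) \<le> w S"
      unfolding f(3)[symmetric] using finS f(1) by (auto intro: sum_mono2)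
    then show ?thesis unfolding Z_def using X0 S(4) by (auto simp: abs_mult intro!: mult_mono)
  qed
  have Eb: "0 \<le> E g \<and> E g \<le> w A" for g
    unfolding E_def using restricted_value_bounds
    by (intro conjI integral_nonneg_AE measure_pmf.integral_le_const
      integrable_pmf_bounded[where K = "w A"]) auto
  have pointwise: "(Z g / w S - 7 / 64 * w S) / 54 \<le> E g" for g
  proof -
    let ?T = "{i\<in>A. g i}" and ?f = "xos_supp A w (s g)"
    have sA: "s g \<subseteq> A" using s[of g] by blast
    have "xos_topt B w ?T c \<le> w S" unfolding S(3) opt_val_def xos_topt_def
      using fin Bpos by (intro Max_mono image_mono) (auto intro: exI[of _ "{}"])
    then obtain S' where S': "S' \<subseteq> s g" "sum c S' \<le> B" "(Z g / w S - 7 / 64 * w S) / 18 \<le> sum ?f S'"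
      using sstar_affordable_subset[of ?T c S f] c S f unfolding s_def Z_def by auto
    have "sum ?f S' \<le> 3 * measure_pmf.expectation (addm ?f (s g)) (\<lambda>m. sum ?f (fst (m c)))"
      by (rule addm_approx[OF sA c S'(1,2)])
    \<comment> \<open>AddM is judged by the additive function \<open>?f\<close>, which lies below
      \<open>w\<close> on all subsets of \<open>A\<close>.\<close>
    also have "measure_pmf.expectation (addm ?f (s g)) (\<lambda>m. sum ?f (fst (m c))) \<le> E g"
      unfolding E_def
    proof (rule expectation_mono_pmf[where K = "w A" and L = "w A"])
      fix m assume "m \<in> set_pmf (addm ?f (s g))"
      then have m: "fst (m c) \<subseteq> A" using addm_mech(4)[OF sA _ c] sA by blast
      then have "fst (m c) \<inter> A = fst (m c)" by blast
      then show "sum ?f (fst (m c)) \<le> w (fst (m c) \<inter> A)"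
        using xos_supp(2)[OF sA m] by simp
      then show "\<bar>sum ?f (fst (m c))\<bar> \<le> w A"
        using restricted_value_bounds[of "fst (m c)"] xos_supp(1)[OF sA] by (simp add: sum_nonneg)
    qed (use restricted_value_bounds in auto)
    finally show ?thesis using S'(3) by simp
  qed
  have intZ: "integrable (measure_pmf P) Z" using Zb by (rule integrable_pmf_bounded)
  have "(((w S)\<^sup>2 - (\<Sum>i\<in>S. (f i)\<^sup>2)) / (4 * w S) - 7 / 64 * w S) / 54 =
      (measure_pmf.expectation P Z / w S - 7 / 64 * w S) / 54"
    unfolding Z_def P_def expectation_split_product[OF fin S(1)] f(3) by simp
  also have "\<dots> = measure_pmf.expectation P (\<lambda>g. (Z g / w S - 7 / 64 * w S) / 54)"
    using intZ by simp
  also have "\<dots> \<le> measure_pmf.expectation P E"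
    using pointwise intZ Eb
    by (intro integral_mono_AE integrable_pmf_bounded[where K = "w A" and h = E]) auto
  finally show ?thesis using E by simp
qed

lemma xos_main_approx:
  assumes c: "valid_bids A B c"
  shows "opt_val A B w c \<le>
    768 * measure_pmf.expectation (xos_main A B w prio addm) (\<lambda>m. w (fst (m c) \<inter> A))"
    (is "_ \<le> 768 * ?E")
proof -
  have "opt_val A B w c \<in> w ` {S. S \<subseteq> A \<and> sum c S \<le> B}"
    unfolding opt_val_def using fin Bpos by (intro Max_in) (auto intro: exI[of _ "{}"])
  then obtain S where S: "S \<subseteq> A" "sum c S \<le> B" "w S = opt_val A B w c" by auto
  show ?thesis
  proof (cases "w S = 0")
    case True
    have "0 \<le> ?E" using restricted_value_bounds by (intro integral_nonneg_AE) auto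
    then show ?thesis using True S by simp
  next
    case False
    then have pos: "0 < w S" using w_nonneg[OF S(1)] by simp
    obtain f where f: "\<And>i. 0 \<le> f i" "\<And>T. T \<subseteq> A \<Longrightarrow> sum f T \<le> w T" "sum f S = w S"
      using supporting_additive[OF S(1)] by blast
    obtain i where i: "i \<in> A" "\<And>j. j \<in> A \<Longrightarrow> w {j} \<le> w {i}"
      "max_item_mech A B w = (\<lambda>b. ({i}, \<lambda>j. if j = i then B else 0))"
      using max_item by blast
    \<comment> \<open>The diagonal loss is charged to the best single item, since
      \<open>f j \<le> w {j} \<le> w {i}\<close>.\<close>
    have "(\<Sum>j\<in>S. (f j)\<^sup>2) \<le> (\<Sum>j\<in>S. w {i} * f j)"
    proof (rule sum_mono)
      fix j assume "j \<in> S"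
      then have "f j \<le> w {i}" using f(2)[of "{j}"] i(2)[of j] S(1) by auto
      then show "(f j)\<^sup>2 \<le> w {i} * f j" using f(1) by (simp add: power2_eq_square mult_right_mono)
    qed
    also have "\<dots> = w {i} * w S" using f(3) by (simp add: sum_distrib_left[symmetric])
    finally have sq: "(w S)\<^sup>2 - (\<Sum>j\<in>S. (f j)\<^sup>2) \<ge> (w S - w {i}) * w S"
      by (simp add: power2_eq_square algebra_simps)
    define q where "q = ((w S)\<^sup>2 - (\<Sum>j\<in>S. (f j)\<^sup>2)) / (4 * w S)"
    have "(w S - w {i}) / 4 = ((w S - w {i}) * w S) / (4 * w S)" using pos by simp
    also have "\<dots> \<le> q" unfolding q_def using sq pos by (intro divide_right_mono) auto
    finally have "(w S - w {i}) / 4 \<le> q" .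
    moreover have "(q - 7 / 64 * w S) / 54 \<le>
        measure_pmf.expectation (xos_random_sample A B w prio addm) (\<lambda>m. w (fst (m c) \<inter> A))"
      unfolding q_def by (rule xos_random_sample_expectation_ge[OF c S pos f])
    moreover have "0 \<le> w {i}" using w_nonneg i(1) by simp
    moreover have "?E = measure_pmf.expectation (xos_random_sample A B w prio addm)
        (\<lambda>m. w (fst (m c) \<inter> A)) / 2 + w {i} / 2"
      unfolding xos_main_def using i(1)
      by (simp add: expectation_bind_pmf_bounded[where K = "w A"] restricted_value_bounds i(3) Int_absorb2)
    \<comment> \<open>Sampling yields at least
      \<open>(9/64 w S - w {i} / 4) / 54 = w S / 384 - w {i} / 216\<close>. The coin halves this,
      and \<open>w {i} / 2\<close> from the other branch absorbs the loss, leaving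
      \<open>w S / 768\<close>.\<close>
    ultimately show ?thesis unfolding S(3)[symmetric] by argo
  qed
qed

end

section \<open>From the fractional cover back to the original valuation\<close>

lemma subadditive_singleton_pos:
  assumes "finite S" "S \<subseteq> A" "v {} = 0"
    "\<And>S T. S \<subseteq> A \<Longrightarrow> T \<subseteq> A \<Longrightarrow> v (S \<union> T) \<le> v S + v T" "(0::real) < v S"
  shows "\<exists>i\<in>S. 0 < v {i}"
  using assms(1,2,5)
proof (induction S)
  case empty
  then show ?case using assms(3) by simp
next
  case (insert i S)
  have "v (insert i S) \<le> v {i} + v S" using assms(4)[of "{i}" S] insert.prems by simp
  then show ?case using insert by fastforce
qed

theorem theorem1:
  shows "\<exists>C::real. \<forall>(A::nat set) (B::real) (v::nat set \<Rightarrow> real) (prio::nat set \<Rightarrow> nat) addm.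
    finite A \<and> A \<noteq> {} \<and> 0 < B \<and>
    (\<forall>S. S \<subseteq> A \<longrightarrow> 0 \<le> v S) \<and> v {} = 0 \<and>
    (\<forall>S T. S \<subseteq> T \<longrightarrow> T \<subseteq> A \<longrightarrow> v S \<le> v T) \<and>
    (\<forall>S T. S \<subseteq> A \<longrightarrow> T \<subseteq> A \<longrightarrow> v (S \<union> T) \<le> v S + v T) \<and>
    inj_on prio (Pow A) \<and>
    addm_ok A B addm
    \<longrightarrow> universally_truthful A B (sa_mech A B v prio addm) \<and>
        universally_budget_feasible A B (sa_mech A B v prio addm) \<and>
        (\<forall>c. valid_bids A B c \<longrightarrow>
           opt_val A B v c \<le> C * gapI A v *
             measure_pmf.expectation (sa_mech A B v prio addm) (\<lambda>m. v (fst (m c))))"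
proof (intro exI[of _ 768] allI impI, elim conjE)
  fix A :: "nat set" and B :: real and v :: "nat set \<Rightarrow> real" and prio :: "nat set \<Rightarrow> nat"
    and addm :: "(nat \<Rightarrow> real) \<Rightarrow> nat set \<Rightarrow> mech pmf"
  assume A: "finite A" "A \<noteq> {}" and B: "0 < B" and v0': "\<forall>S. S \<subseteq> A \<longrightarrow> 0 \<le> v S" and "v {} = 0"
    and mono': "\<forall>S T. S \<subseteq> T \<longrightarrow> T \<subseteq> A \<longrightarrow> v S \<le> v T"
    and sub: "\<forall>S T. S \<subseteq> A \<longrightarrow> T \<subseteq> A \<longrightarrow> v (S \<union> T) \<le> v S + v T"
    and prio: "inj_on prio (Pow A)" and addm: "addm_ok A B addm"
  define w where "w = frac_cover A v"
  have v0: "0 \<le> v S" if "S \<subseteq> A" for S using v0' that by blast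
  have mono: "v S \<le> v T" if "S \<subseteq> T" "T \<subseteq> A" for S T using mono' that by blast
  interpret xos_procurement A B w prio addm
    using A B prio addm xos_on_frac_cover[OF A(1) v0] by unfold_locales (auto simp: w_def)
  have wv: "w S \<le> v S" if "S \<subseteq> A" for S using frac_cover_le[OF A(1) v0 that] by (simp add: w_def)
  have gap_ge: "gap_ratio A v S \<le> gapI A v" if "S \<subseteq> A" for S
    unfolding gapI_def using A that by (intro Max_ge) auto
  have gap0: "0 \<le> gapI A v" using gap_ge[of "{}"] \<open>v {} = 0\<close> by (simp add: gap_ratio_def)
  \<comment> \<open>Multiplying out the gap ratio requires \<open>w S > 0\<close>. Subadditivity
    yields an item of positive value in \<open>S\<close>, and \<open>w S\<close> is at least that
    value.\<close>
  have vw: "v S \<le> gapI A v * w S" if S: "S \<subseteq> A" for S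
  proof (cases "v S = 0")
    case True
    then show ?thesis using gap0 w_nonneg[OF S] by simp
  next
    case False
    then have "0 < v S" using v0[OF S] by simp
    then obtain i where i: "i \<in> S" "0 < v {i}"
      using subadditive_singleton_pos[of S A v] sub S A \<open>v {} = 0\<close> finite_subset by blast
    have "v {i} \<le> w S"
      using frac_cover_singleton_le[OF A(1) v0 mono S i(1)] by (simp add: w_def)
    then have "0 < w S" using i by simp
    moreover have "v S / w S \<le> gapI A v" using gap_ge[OF S] False by (simp add: gap_ratio_def w_def)
    ultimately show ?thesis by (simp add: field_simps)
  qed
  have sa: "sa_mech A B v prio addm = xos_main A B w prio addm" by (simp add: sa_mech_def w_def)
  have approx: "opt_val A B v c \<le> 768 * gapI A v *
      measure_pmf.expectation (sa_mech A B v prio addm) (\<lambda>m. v (fst (m c)))"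
    if c: "valid_bids A B c" for c
  proof -
    have "opt_val A B v c \<in> v ` {S. S \<subseteq> A \<and> sum c S \<le> B}"
      unfolding opt_val_def using A B by (intro Max_in) (auto intro: exI[of _ "{}"])
    then obtain S where S: "S \<subseteq> A" "sum c S \<le> B" "v S = opt_val A B v c" by auto
    have win: "fst (m c) \<subseteq> A" if "m \<in> set_pmf (xos_main A B w prio addm)" for m
      using xos_main_mech(1)[OF that] c by (auto simp: is_mech_def)
    \<comment> \<open>The optimum \<open>S\<close> for \<open>v\<close> is a feasible competitor for
      \<open>w\<close>; \<open>opt_val\<close> is \<open>xos_topt\<close> with all of
      \<open>A\<close> as the sample.\<close>
    have "w S \<le> opt_val A B w c" using xos_topt_ge[of A S c] S by (simp add: opt_val_def xos_topt_def)
    also have "\<dots> \<le> 768 * measure_pmf.expectation (xos_main A B w prio addm) (\<lambda>m. w (fst (m c) \<inter> A))"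
      by (rule xos_main_approx[OF c])
    also have "measure_pmf.expectation (xos_main A B w prio addm) (\<lambda>m. w (fst (m c) \<inter> A)) \<le>
        measure_pmf.expectation (xos_main A B w prio addm) (\<lambda>m. v (fst (m c)))"
    proof (rule expectation_mono_pmf[where K = "w A" and L = "v A"])
      fix m assume "m \<in> set_pmf (xos_main A B w prio addm)"
      note m = win[OF this]
      then have "fst (m c) \<inter> A = fst (m c)" by blast
      then show "w (fst (m c) \<inter> A) \<le> v (fst (m c))" using wv[OF m] by simp
      show "\<bar>v (fst (m c))\<bar> \<le> v A" using v0[OF m] mono[OF m] by simp
    qed (use restricted_value_bounds in auto)
    finally have "gapI A v * w S \<le> gapI A v *
        (768 * measure_pmf.expectation (xos_main A B w prio addm) (\<lambda>m. v (fst (m c))))"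
      using gap0 by (intro mult_left_mono) auto
    then show ?thesis using vw[OF S(1)] S(3) sa by (simp add: mult_ac)
  qed
  show "universally_truthful A B (sa_mech A B v prio addm) \<and>
        universally_budget_feasible A B (sa_mech A B v prio addm) \<and>
        (\<forall>c. valid_bids A B c \<longrightarrow>
           opt_val A B v c \<le> 768 * gapI A v *
             measure_pmf.expectation (sa_mech A B v prio addm) (\<lambda>m. v (fst (m c))))"
    using xos_main_mech approx
    by (auto simp: universally_truthful_def universally_budget_feasible_def sa)
qed

end
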